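(* For every integer $k\ge 1$, $$J_k(z,q)\in\mathbb Z_{\ge0}[z,z^{-1}][[q]].$$ Equivalently, $[q^{n}z^{s}]\,J_k(z,q)\ge0$ for all integers $n\ge0$ and all $s\in\mathbb Z$.
   Context: All series are formal and live in the ring $\mathbb Z[z,z^{-1}][[q]]$ of formal power series in $q$ whose coefficients are Laurent polynomials in $z$; $[q^nz^s]F$ denotes the coefficient of $q^nz^s$ in $F$. Write $(a;q)_\infty=\prod_{n\ge0}(1-aq^n)$ and $(a_1,\dots,a_t;q)_\infty=\prod_{i=1}^t(a_i;q)_\infty$. For $j\ge 0$ let $T_j=\binom{j+1}{2}$ and $\chi_j(z)=\sum_{u=-j}^{j}z^u$. For an integer $k\ge1$ define $$J_k(z,q)=\frac{\sum_{j=k}^{\infty}(-1)^{j-k}q^{T_j}\chi_j(z)}{(zq,q/z;q)_\infty}.$$ *)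

theory Defs
  imports "HOL-Analysis.Analysis" "HOL-Library.Poly_Mapping"
begin

text \<open>
  The ring of Laurent polynomials in \<open>z\<close> over the integers is the type \<open>int \<Rightarrow>\<^sub>0 int\<close> of finitely
  supported functions from exponents to coefficients, multiplied by convolution.
  The type \<open>qzseries\<close> is the ring of formal power series in \<open>q\<close> over it, and \<open>q\<close> is \<open>fps_X\<close>.
  Infinite sums and products are those of the library, taken in the \<open>q\<close>-adic topology.
\<close>

type_synonym laurent = "int \<Rightarrow>\<^sub>0 int"
type_synonym qzseries = "laurent fps"

definition zpow :: "int \<Rightarrow> laurent" where
  "zpow u = Poly_Mapping.single u 1"

definition qzcoeff :: "qzseries \<Rightarrow> nat \<Rightarrow> int \<Rightarrow> int" where
  "qzcoeff F n s = Poly_Mapping.lookup (fps_nth F n) s"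

definition qpoch_inf :: "qzseries \<Rightarrow> qzseries" where
  "qpoch_inf a = prodinf (\<lambda>n. 1 - a * fps_X ^ n)"

definition qpochs_inf :: "qzseries list \<Rightarrow> qzseries" where
  "qpochs_inf as = (\<Prod>a\<leftarrow>as. qpoch_inf a)"

definition Tri :: "nat \<Rightarrow> nat" where
  "Tri j = (j + 1) choose 2"

definition chi :: "nat \<Rightarrow> laurent" where
  "chi j = (\<Sum>u = - int j..int j. zpow u)"

definition J_num :: "nat \<Rightarrow> qzseries" where
  "J_num k = (\<Sum>\<^sub>\<infinity>j\<in>{k..}. (- 1) ^ (j - k) * fps_X ^ Tri j * fps_const (chi j))"

definition J_den :: qzseries where
  "J_den = qpochs_inf [fps_const (zpow 1) * fps_X, fps_const (zpow (- 1)) * fps_X]"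

text \<open>
  The coefficient ring is not a field, so the division of the library is not available for
  \<open>qzseries\<close>. The constant coefficient of the denominator is \<open>1\<close>; the second argument of
  \<open>fps_right_inverse\<close> is the inverse of that coefficient. Lemma \<open>J_unique\<close> below shows that
  this is the quotient.
\<close>
definition J :: "nat \<Rightarrow> qzseries" where
  "J k = J_num k * fps_right_inverse J_den 1"


text \<open>The infinite sum and products converge, so none of them takes a default value.\<close>

lemma qpoch_inf_aux:
  fixes a :: qzseries
  assumes "fps_nth a 0 = 0"
  shows "\<exists>P. (\<lambda>n. 1 - a * fps_X ^ n) has_prod P \<and> fps_nth P 0 = 1"
proof -
  let ?f = "\<lambda>i. 1 - a * fps_X ^ i"
  define P where "P = Abs_fps (\<lambda>n. fps_nth (\<Prod>i\<le>n. ?f i) n)"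
  have stable: "fps_nth (\<Prod>i\<le>n + d. ?f i) n = fps_nth (\<Prod>i\<le>n. ?f i) n" for n d
  proof (induction d)
    case (Suc d)
    have "fps_nth (\<Prod>i\<le>n + Suc d. ?f i) n =
        fps_nth ((\<Prod>i\<le>n + d. ?f i) - (\<Prod>i\<le>n + d. ?f i) * a * fps_X ^ (n + d + 1)) n"
      by (simp add: algebra_simps)
    also have "\<dots> = fps_nth (\<Prod>i\<le>n + d. ?f i) n"
      by (simp only: fps_sub_nth fps_X_power_mult_right_nth) simp
    finally show ?case using Suc by simp
  qed simp
  have "(\<lambda>n. \<Prod>i\<le>n. ?f i) \<longlonglongrightarrow> P"
  proof (rule tendsto_fpsI)
    fix n
    show "\<forall>\<^sub>F m in sequentially. fps_nth (\<Prod>i\<le>m. ?f i) n = fps_nth P n"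
      using eventually_ge_at_top[of n]
    proof eventually_elim
      case (elim m)
      then show ?case using stable[of n "m - n"] by (simp add: P_def)
    qed
  qed
  moreover have P0: "fps_nth P 0 = 1"
    using assms by (simp add: P_def)
  moreover from P0 have "P \<noteq> 0" by auto
  ultimately show ?thesis
    by (auto simp: has_prod_def raw_has_prod_def)
qed

lemma qpoch_inf_has_prod:
  assumes "fps_nth a 0 = 0"
  shows "(\<lambda>n. 1 - a * fps_X ^ n) has_prod qpoch_inf a"
proof -
  obtain P where P: "(\<lambda>n. 1 - a * fps_X ^ n) has_prod P"
    using qpoch_inf_aux[OF assms] by blast
  then show ?thesis
    using has_prod_unique[OF P] by (simp add: qpoch_inf_def)
qed

lemma qpoch_inf_nth_0:
  assumes "fps_nth a 0 = 0"
  shows "fps_nth (qpoch_inf a) 0 = 1"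
proof -
  obtain P where P: "(\<lambda>n. 1 - a * fps_X ^ n) has_prod P" "fps_nth P 0 = 1"
    using qpoch_inf_aux[OF assms] by blast
  then show ?thesis
    using has_prod_unique[OF P(1)] by (simp add: qpoch_inf_def)
qed

lemma J_num_has_sum:
  "((\<lambda>j. (- 1) ^ (j - k) * fps_X ^ Tri j * fps_const (chi j)) has_sum J_num k) {k..}"
proof -
  let ?F = "\<lambda>j. (- 1) ^ (j - k) * fps_X ^ Tri j * fps_const (chi j) :: qzseries"
  have Tri_ge: "j \<le> Tri j" for j
    by (induction j) (auto simp: Tri_def numeral_2_eq_2)
  have zero: "fps_nth (?F j) n = 0" if "n < j" for j n
  proof -
    have "?F j = fps_X ^ Tri j * ((- 1) ^ (j - k) * fps_const (chi j))"
      by (simp add: algebra_simps)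
    then show ?thesis
      using that Tri_ge[of j] by (simp only: fps_X_power_mult_nth) simp
  qed
  have "{j \<in> {k..}. fps_nth (?F j) n \<noteq> 0} \<subseteq> {..n}" for n
  proof
    fix j assume "j \<in> {j \<in> {k..}. fps_nth (?F j) n \<noteq> 0}"
    then have "\<not> n < j"
      using zero[of n j] by blast
    then show "j \<in> {..n}" by simp
  qed
  then have "finite {j \<in> {k..}. fps_nth (?F j) n \<noteq> 0}" for n
    by (rule finite_subset) simp
  then have "(?F has_sum
      Abs_fps (\<lambda>n. \<Sum>j | j \<in> {k..} \<and> fps_nth (?F j) n \<noteq> 0. fps_nth (?F j) n)) {k..}"
    by (intro has_sum_fpsI) simp_all
  then show ?thesis
    unfolding J_num_def by (rule has_sum_infsum[OF has_sum_imp_summable])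
qed

lemma J_den_nth_0: "fps_nth J_den 0 = 1"
  by (simp add: J_den_def qpochs_inf_def qpoch_inf_nth_0)

lemma J_times_den: "J k * J_den = J_num k"
proof -
  have "J_den * fps_right_inverse J_den 1 = 1"
    by (rule fps_right_inverse) (simp add: J_den_nth_0)
  then have "J_num k * (J_den * fps_right_inverse J_den 1) = J_num k"
    by (simp only: mult_1_right)
  then show ?thesis
    by (simp only: J_def mult_ac)
qed

lemma J_unique: "F * J_den = J_num k \<longleftrightarrow> F = J k"
proof -
  have "J_den \<noteq> 0"
    using J_den_nth_0 by auto
  then show ?thesis
    using J_times_den[of k] by (metis mult_right_cancel)
qed

end

theory Submission
  imports Defs
begin

text \<open>
  Write \<open>(q)\<^sub>N\<close> for \<open>(1 - q) \<dots> (1 - q\<^sup>N)\<close> and \<open>T\<^sub>i = i (i + 1) / 2\<close>, introduce a second variable \<open>t\<close> with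
  \<open>c = t + 1/t\<close>, and put \<open>g\<^sub>m = (1 + t q\<^sup>m) (1 + q\<^sup>m / t) = 1 + q\<^sup>2\<^sup>m + q\<^sup>m c\<close> and \<open>F = g\<^sub>1 g\<^sub>2 g\<^sub>3 \<dots>\<close>.
  For a polynomial \<open>p\<close> in \<open>c\<close> let \<open>mult\<^sub>k p\<close> be the coefficient of \<open>t\<^sup>k\<close> in \<open>(t - 1/t) p\<close>. If \<open>p\<close> is
  the character of a representation of \<open>SL\<^sub>2\<close>, this is the multiplicity of the irreducible
  representation of dimension \<open>k\<close>; since \<open>c\<close> is itself a character, \<open>mult\<^sub>k c\<^sup>r\<close> is a
  natural number, and polynomials in \<open>c\<close> with nonnegative coefficients have nonnegative
  multiplicities. The theorem follows from the formula
  \<open>[z\<^sup>s] J\<^sub>k = mult\<^sub>k y\<^sub>s / (q)\<^sub>\<infinity>\<close>, where \<open>y\<^sub>s = q\<^bsup>|s|\<^esup> F / g\<^bsub>|s|\<^esub>\<close> for \<open>s \<noteq> 0\<close> and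
  \<open>y\<^sub>0 = (F - (q)\<^sub>\<infinity>\<^sup>2) / (c + 2)\<close>.

  \<^bold>\<open>Positivity.\<close> For \<open>s \<noteq> 0\<close> the formula is a product of factors with nonnegative coefficients. For
  \<open>s = 0\<close> note that \<open>(q)\<^sub>\<infinity>\<^sup>2\<close> is the value of \<open>F\<close> at \<open>c = -2\<close>, so \<open>y\<^sub>0\<close> is a divided difference; adding the
  factors of \<open>F\<close> one at a time shows that both \<open>y\<^sub>0 / (q)\<^sub>\<infinity>\<close> and \<open>(F - y\<^sub>0) / (q)\<^sub>\<infinity>\<close> have nonnegative
  coefficients (\<open>nonneg_poly_F_quot\<close>).

  \<^bold>\<open>The formula.\<close> Multiply \<open>\<Sum>\<^sub>s z\<^sup>s mult\<^sub>k y\<^sub>s\<close> by \<open>(1 - z) (q, z q, q/z; q)\<^sub>\<infinity>\<close>, which the Jacobi triple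
  product expands as \<open>\<Sum>\<^sub>i (-1)\<^sup>i q\<^bsup>T\<^sub>i\<^esup> z\<^bsup>-i\<^esup>\<close>. The coefficient of \<open>z\<^bsup>-i\<^esup>\<close> becomes \<open>(-1)\<^sup>i\<close> times the moment
  \<open>w\<^sub>i(k) = \<Sum>\<^sub>s (-1)\<^sup>s q\<^bsup>T\<^sub>i\<^sub>+\<^sub>s\<^esup> mult\<^sub>k y\<^sub>s\<close>, and comparison with the numerator of \<open>J\<^sub>k\<close> shows that the claim is
  \<open>w\<^sub>i(k) = (-1)\<^sup>k q\<^bsup>T\<^sub>i\<^esup> (q)\<^sub>\<infinity>\<^sup>2\<close> for \<open>i \<ge> k\<close> and \<open>w\<^sub>i(k) = 0\<close> for \<open>0 \<le> i < k\<close> (\<open>moment_congr\<close>); negative \<open>i\<close> reduce to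
  these by \<open>T\<^bsub>-1-i\<^esub> = T\<^sub>i\<close>. Up to the correction at \<open>s = 0\<close>, \<open>y\<^sub>s\<close> is \<open>F\<close> divided by \<open>c + q\<^sup>s + q\<^bsup>-s\<^esup>\<close>: the \<open>y\<^sub>s\<close> are the
  Lagrange interpolation polynomials for the nodes \<open>c = - q\<^sup>s - q\<^bsup>-s\<^esup>\<close>. Passing from \<open>i\<close> to \<open>i + 1\<close> and
  to \<open>i - 1\<close> multiplies the terms of the moment by \<open>q\<^sup>s\<close> and by \<open>q\<^bsup>-s\<^esup>\<close>, up to a common factor; so
  \<open>w\<^sub>i\<^sub>+\<^sub>1 + q\<^sup>2\<^sup>i\<^sup>+\<^sup>1 w\<^sub>i\<^sub>-\<^sub>1\<close> differs from \<open>- q\<^sup>i\<^sup>+\<^sup>1\<close> times the moment of \<open>c y\<^sub>s\<close> by a multiple of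
  \<open>\<Sum>\<^sub>s (-1)\<^sup>s q\<^bsup>T\<^sub>i\<^sub>+\<^sub>s\<^esup>\<close>, which vanishes, and by the contribution of the correction at \<open>s = 0\<close>. As
  \<open>mult\<^sub>k (c p) = mult\<^sub>k\<^sub>-\<^sub>1 p + mult\<^sub>k\<^sub>+\<^sub>1 p\<close>, this is a recurrence for \<open>w\<^sub>i(k)\<close> (\<open>moment_recurrence\<close>), which the
  claimed values satisfy. Its initial value \<open>w\<^sub>0 = 0\<close> comes from an exact identity for the finite
  products, weighted with \<open>q\<close>-binomial coefficients (\<open>qbin_quot_node_poly_sum\<close>).

  All infinite products are truncated after \<open>N\<close> factors, and identities are taken modulo \<open>q\<^sup>N\<^sup>+\<^sup>1\<close>;
  this determines the coefficients of \<open>J\<^sub>k\<close> up to \<open>q\<^sup>N\<close>.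
\<close>

section \<open>Congruences in a commutative ring\<close>

definition congr :: "'a::comm_ring_1 \<Rightarrow> 'a \<Rightarrow> 'a \<Rightarrow> bool" where
  "congr m a b \<longleftrightarrow> m dvd a - b"

lemma congr_refl [simp]: "congr m a a"
  by (simp add: congr_def)

lemma congr_sym: "congr m a b \<Longrightarrow> congr m b a"
  unfolding congr_def by (subst minus_diff_eq[symmetric]) (simp only: dvd_minus_iff)

lemma congr_trans [trans]: "congr m a b \<Longrightarrow> congr m b c \<Longrightarrow> congr m a c"
  unfolding congr_def using dvd_add[of m "a - b" "b - c"] by simp

lemma congr_add: "congr m a b \<Longrightarrow> congr m c d \<Longrightarrow> congr m (a + c) (b + d)"
  unfolding congr_def using dvd_add[of m "a - b" "c - d"] by (simp add: algebra_simps)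

lemma congr_diff: "congr m a b \<Longrightarrow> congr m c d \<Longrightarrow> congr m (a - c) (b - d)"
  unfolding congr_def using dvd_diff[of m "a - b" "c - d"] by (simp add: algebra_simps)

lemma congr_mult: "congr m a b \<Longrightarrow> congr m c d \<Longrightarrow> congr m (a * c) (b * d)"
proof -
  assume "congr m a b" "congr m c d"
  then have "m dvd (a - b) * c + b * (c - d)"
    unfolding congr_def by (intro dvd_add dvd_mult dvd_mult2)
  then show ?thesis
    by (simp add: congr_def algebra_simps)
qed

lemma congr_sum: "(\<And>i. i \<in> S \<Longrightarrow> congr m (f i) (g i)) \<Longrightarrow> congr m (sum f S) (sum g S)"
  unfolding congr_def by (simp flip: sum_subtractf add: dvd_sum)

text \<open>
  A factor that is divisible by a high power of \<open>q\<close> makes up for a congruence that holds only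
  modulo a low power; in this way the weights in sums over \<open>s\<close> are replaced by constants below.
\<close>
lemma congr_mult_dvd:
  assumes "congr m a b" "m' dvd c" "n dvd m' * m"
  shows "congr n (c * a) (c * b)"
  unfolding congr_def right_diff_distrib[symmetric]
  using assms by (meson congr_def dvd_trans mult_dvd_mono)

lemma congr_cancel_unit:
  assumes "congr m (u * a) (u * b)" "v * u = 1"
  shows "congr m a b"
proof -
  have "m dvd v * (u * a - u * b)"
    using assms(1) by (simp add: congr_def)
  moreover have "v * (u * a - u * b) = (v * u) * (a - b)"
    by (simp add: algebra_simps)
  ultimately show ?thesis
    using assms(2) by (simp add: congr_def)
qed

section \<open>Powers of q, triangular numbers and finite q-factorials\<close>

text \<open>
  Exponents are integers because they come from expressions such as \<open>N - i\<close>. Negative exponents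
  give \<open>1\<close>, so that a congruence modulo \<open>qpow r\<close> with \<open>r \<le> 0\<close> holds trivially.
\<close>
definition qpow :: "int \<Rightarrow> 'a::comm_ring_1 fps" where
  "qpow i = fps_X ^ nat i"

lemma qpow_0 [simp]: "qpow 0 = 1"
  by (simp add: qpow_def)

lemma qpow_add: "0 \<le> a \<Longrightarrow> 0 \<le> b \<Longrightarrow> qpow (a + b) = qpow a * qpow b"
  by (simp add: qpow_def nat_add_distrib power_add)

lemma qpow_dvd: "a \<le> b \<Longrightarrow> qpow a dvd qpow b"
  by (simp add: qpow_def le_imp_power_dvd)

definition tri :: "int \<Rightarrow> int" where
  "tri i = i * (i + 1) div 2"

lemma tri_double: "2 * tri i = i * (i + 1)"
  by (simp add: tri_def)

lemma tri_0 [simp]: "tri 0 = 0"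
  by (simp add: tri_def)

lemma tri_plus_1: "tri (i + 1) = tri i + i + 1"
  using tri_double[of i] tri_double[of "i + 1"] by (simp add: algebra_simps)

lemma tri_minus_1: "tri (i - 1) = tri i - i"
  using tri_plus_1[of "i - 1"] by simp

lemma tri_reflect: "tri (- 1 - i) = tri i"
  using tri_double[of i] tri_double[of "- 1 - i"] by (simp add: algebra_simps)

lemma tri_ge: "i \<le> tri i" "- i - 1 \<le> tri i"
proof -
  have "0 \<le> (i - 1) * i" for i :: int
    by (cases "i \<le> 0") (auto intro: mult_nonneg_nonneg mult_nonpos_nonpos)
  from this[of i] this[of "- i - 1"] show "i \<le> tri i" "- i - 1 \<le> tri i"
    using tri_double[of i] by (auto simp: algebra_simps)
qed

lemma tri_nonneg [simp]: "0 \<le> tri i"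
  using tri_ge[of i] by linarith

definition alt_sign :: "int \<Rightarrow> 'a::comm_ring_1" where
  "alt_sign i = (if even i then 1 else - 1)"

lemma alt_sign_simps [simp]:
  "alt_sign 0 = 1" "alt_sign (- i) = alt_sign i"
  "alt_sign (i + 1) = - alt_sign i" "alt_sign (i - 1) = - alt_sign i"
  by (auto simp: alt_sign_def)

lemma alt_sign_add: "alt_sign (i + j) = alt_sign i * alt_sign j"
  by (auto simp: alt_sign_def)

definition geom :: "nat \<Rightarrow> 'a::comm_ring_1 fps" where
  "geom m = Abs_fps (\<lambda>n. if m dvd n then 1 else 0)"

lemma geom_inverse:
  assumes "0 < m"
  shows "(1 - fps_X ^ m) * geom m = 1"
proof (rule fps_ext)
  fix n
  have "fps_nth ((1 - fps_X ^ m) * geom m) n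
      = fps_nth (geom m) n - (if n < m then 0 else fps_nth (geom m) (n - m))"
    by (simp add: left_diff_distrib fps_X_power_mult_nth)
  also have "\<dots> = fps_nth 1 n"
    using assms by (auto simp: geom_def dvd_minus_self dest: dvd_imp_le)
  finally show "fps_nth ((1 - fps_X ^ m) * geom m) n = fps_nth (1 :: 'a fps) n" .
qed

definition qfac :: "nat \<Rightarrow> 'a::comm_ring_1 fps" where
  "qfac n = (\<Prod>m = 1..n. 1 - fps_X ^ m)"

definition iqfac :: "nat \<Rightarrow> 'a::comm_ring_1 fps" where
  "iqfac n = (\<Prod>m = 1..n. geom m)"

lemma qfac_simps [simp]: "qfac 0 = 1" "qfac (Suc n) = (1 - fps_X ^ Suc n) * qfac n"
  by (simp_all add: qfac_def mult.commute)

lemma iqfac_simps [simp]: "iqfac 0 = 1" "iqfac (Suc n) = geom (Suc n) * iqfac n"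
  by (simp_all add: iqfac_def mult.commute)

lemma iqfac_qfac: "iqfac n * qfac n = 1"
  unfolding iqfac_def qfac_def prod.distrib[symmetric]
  by (rule prod.neutral) (auto simp: geom_inverse mult.commute[of "geom _"])

lemma qfac_congr:
  assumes "k \<le> a" "k \<le> b"
  shows "congr (fps_X ^ Suc k) (qfac a) (qfac b)"
proof -
  have *: "congr (fps_X ^ Suc k) (qfac (k + d)) (qfac k)" for d
  proof (induction d)
    case (Suc d)
    have "congr (fps_X ^ Suc k) (qfac (k + Suc d)) (qfac (k + d))"
      by (simp add: congr_def left_diff_distrib le_imp_power_dvd dvd_mult2 del: power_Suc)
    then show ?case
      using Suc congr_trans by blast
  qed simp
  show ?thesis
    using congr_trans[OF *[of "a - k"] congr_sym[OF *[of "b - k"]]] assms by simp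
qed

text \<open>
  The value \<open>0\<close> at negative arguments is what the recurrence \<open>1 / (q)\<^sub>i\<^sub>-\<^sub>1 = (1 - q\<^sup>i) / (q)\<^sub>i\<close> gives at \<open>i = 0\<close>.
\<close>
definition iqfac_int :: "int \<Rightarrow> 'a::comm_ring_1 fps" where
  "iqfac_int i = (if i < 0 then 0 else iqfac (nat i))"

lemma iqfac_int_minus_1:
  assumes "0 \<le> i"
  shows "iqfac_int (i - 1) = (1 - qpow i) * iqfac_int i"
proof (cases "i = 0")
  case False
  define n where "n = nat (i - 1)"
  have i: "i = int (Suc n)" using False assms by (simp add: n_def)
  have "(1 - fps_X ^ Suc n) * (geom (Suc n) * iqfac n) = (iqfac n :: 'a fps)"
    using geom_inverse[of "Suc n", where 'a = 'a] by (simp add: mult.assoc[symmetric])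
  then show ?thesis
    by (simp add: iqfac_int_def qpow_def i nat_add_distrib)
qed (simp add: iqfac_int_def)

text \<open>
  The \<open>q\<close>-binomial coefficient of \<open>2 M\<close> over \<open>M + s\<close>, divided by \<open>(q)\<^bsub>2M\<^esub>\<close>. With this normalization
  the values at \<open>M\<close> arise from those at \<open>M + 1\<close> by multiplication by two factors, also at the ends
  \<open>|s| = M + 1\<close>, where one of the factors is \<open>0\<close>.
\<close>
definition qbin_quot :: "int \<Rightarrow> int \<Rightarrow> 'a::comm_ring_1 fps" where
  "qbin_quot M s = iqfac_int (M + s) * iqfac_int (M - s)"

lemma qbin_quot_eq_0: "\<bar>s\<bar> > M \<Longrightarrow> qbin_quot M s = 0"
  by (auto simp: qbin_quot_def iqfac_int_def)

lemma qbin_quot_step: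
  assumes "\<bar>s\<bar> \<le> M + 1"
  shows "qbin_quot M s = (1 - qpow (M + 1 + s)) * (1 - qpow (M + 1 - s))
      * (qbin_quot (M + 1) s :: 'a::comm_ring_1 fps)"
proof -
  have "iqfac_int (M + s) = (1 - qpow (M + 1 + s)) * (iqfac_int (M + 1 + s) :: 'a fps)"
    using iqfac_int_minus_1[of "M + 1 + s", where 'a = 'a] assms by (simp add: algebra_simps)
  moreover have "iqfac_int (M - s) = (1 - qpow (M + 1 - s)) * (iqfac_int (M + 1 - s) :: 'a fps)"
    using iqfac_int_minus_1[of "M + 1 - s", where 'a = 'a] assms by (simp add: algebra_simps)
  ultimately show ?thesis
    by (simp only: qbin_quot_def mult_ac)
qed

text \<open>
  The \<open>q\<close>-Pascal rule applied twice. In terms of \<open>A = q\<^sup>a\<close>, \<open>B = q\<^sup>b\<close> with \<open>a = M + 1 + s\<close>, \<open>b = M + 1 - s\<close>, and of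
  \<open>r = q\<^bsup>2M+1\<^esup>\<close>, so that \<open>A B = q r\<close>, all terms are multiples of \<open>1 / ((q)\<^sub>a (q)\<^sub>b)\<close> and the rule becomes
  \<open>(1 - r) (1 - A B) = (1 + r) (1 - A) (1 - B) + (B - r) (1 - A) + (A - r) (1 - B)\<close>.
\<close>
lemma qbin_quot_pascal:
  assumes M: "0 \<le> M" "\<bar>s\<bar> \<le> M + 1"
  shows "(1 - qpow (2 * M + 1)) * (1 - qpow (2 * M + 2)) * qbin_quot (M + 1) s =
    (1 + qpow (2 * M + 1)) * qbin_quot M s + qpow (M + 1 - s) * qbin_quot M (s - 1)
      + qpow (M + 1 + s) * (qbin_quot M (s + 1) :: 'a::comm_ring_1 fps)"
proof -
  define a b where "a = M + 1 + s" and "b = M + 1 - s"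
  have ab: "0 \<le> a" "0 \<le> b" "a + b = 2 * M + 2"
    using M by (auto simp: a_def b_def)
  \<comment> \<open>At \<open>c = 0\<close> both sides vanish: the left by the convention for \<open>iqfac_int\<close>, the right by \<open>1 - q\<^sup>0 = 0\<close>.\<close>
  have half: "qpow d * iqfac_int (c - 2)
      = (qpow d - qpow (2 * M + 1)) * (1 - qpow c) * (iqfac_int c :: 'a fps)"
    if cd: "0 \<le> c" "0 \<le> d" "c + d = 2 * M + 2" for c d
  proof (cases "c = 0")
    case False
    then have eq1: "qpow d * qpow (c - 1) = (qpow (2 * M + 1) :: 'a fps)"
      using cd by (subst qpow_add[symmetric]) (auto intro: arg_cong[where f = qpow])
    have eq2: "iqfac_int (c - 2) = (1 - qpow (c - 1)) * ((1 - qpow c) * (iqfac_int c :: 'a fps))"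
      using False cd iqfac_int_minus_1[of "c - 1", where 'a = 'a] iqfac_int_minus_1[of c, where 'a = 'a] by simp
    show ?thesis
      unfolding eq2 eq1[symmetric] by (simp add: algebra_simps)
  qed (simp add: iqfac_int_def)
  have 1: "qpow b * qbin_quot M (s - 1)
      = (qpow b - qpow (2 * M + 1)) * (1 - qpow a) * (iqfac_int a * iqfac_int b :: 'a fps)"
  proof -
    have "qbin_quot M (s - 1) = iqfac_int (a - 2) * (iqfac_int b :: 'a fps)"
      by (simp add: qbin_quot_def a_def b_def algebra_simps)
    then show ?thesis
      using half[of a b] ab by (simp only: mult.assoc[symmetric])
  qed
  have 2: "qpow a * qbin_quot M (s + 1)
      = (qpow a - qpow (2 * M + 1)) * (1 - qpow b) * (iqfac_int a * iqfac_int b :: 'a fps)"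
  proof -
    have "qbin_quot M (s + 1) = iqfac_int a * (iqfac_int (b - 2) :: 'a fps)"
      by (simp add: qbin_quot_def a_def b_def algebra_simps)
    then have "qpow a * qbin_quot M (s + 1) = qpow a * iqfac_int (b - 2) * (iqfac_int a :: 'a fps)"
      by (simp only: mult_ac)
    also have "qpow a * iqfac_int (b - 2)
        = (qpow a - qpow (2 * M + 1)) * (1 - qpow b) * (iqfac_int b :: 'a fps)"
      using half[of b a] ab by simp
    finally show ?thesis
      by (simp only: mult_ac)
  qed
  have 3: "qbin_quot M s = (1 - qpow a) * (1 - qpow b) * (iqfac_int a * iqfac_int b :: 'a fps)"
    using qbin_quot_step[OF M(2), where 'a = 'a]
        by (simp add: qbin_quot_def a_def b_def algebra_simps)
  have 4: "qpow (2 * M + 2) = (qpow a * qpow b :: 'a fps)"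
    using ab qpow_add[of a b, where 'a = 'a] by simp
  have 5: "qbin_quot (M + 1) s = (iqfac_int a * iqfac_int b :: 'a fps)"
    by (simp add: qbin_quot_def a_def b_def algebra_simps)
  have 6: "qpow (M + 1 - s) = (qpow b :: 'a fps)" "qpow (M + 1 + s) = (qpow a :: 'a fps)"
    by (simp_all add: a_def b_def)
  show ?thesis
    unfolding 6 1 2 3 4 5 by (simp add: algebra_simps)
qed

text \<open>
  The product is a quotient of finite \<open>q\<close>-factorials, two above and two below the bar, which can be
  paired so that those in a pair have no different factor of the form \<open>1 - q\<^sup>m\<close> with \<open>m < r\<close>.
\<close>
lemma qbin_quot_congr:
  assumes "\<bar>s\<bar> \<le> int M" "r \<le> int L + 1" "r \<le> int M - \<bar>s\<bar> + 1"
  shows "congr (qpow r) (qfac L * (qfac (2 * M) * qbin_quot (int M) s)) 1"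
proof -
  define a b where "a = nat (int M + s)" and "b = nat (int M - s)"
  have *: "congr (qpow r) (qfac c) (qfac d :: 'a fps)" if "r \<le> int c + 1" "r \<le> int d + 1" for c d
  proof (cases "r \<le> 0")
    case False
    then have "nat r = Suc (nat (r - 1))" by simp
    then show ?thesis
      unfolding qpow_def using that by (simp only:) (rule qfac_congr; simp)
  qed (simp add: qpow_def congr_def)
  have "congr (qpow r) (qfac L * qfac (2 * M) * (iqfac a * iqfac b))
      (qfac b * qfac a * (iqfac a * iqfac b :: 'a fps))"
    using assms by (intro congr_mult *) (auto simp: a_def b_def)
  also have "qfac b * qfac a * (iqfac a * iqfac b :: 'a fps)
      = (iqfac a * qfac a) * (iqfac b * qfac b)"
    by (simp only: mult_ac)
  finally show ?thesis
    using assms(1) by (auto simp: qbin_quot_def iqfac_int_def iqfac_qfac a_def b_def mult.assoc)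
qed

section \<open>The Jacobi triple product\<close>

lemma sum_shift_int:
  fixes f :: "int \<Rightarrow> 'a::comm_monoid_add"
  shows "(\<Sum>s = a..b. f (s + c)) = (\<Sum>s = a + c..b + c. f s)"
  by (rule sum.reindex_bij_witness[where i = "\<lambda>s. s - c" and j = "\<lambda>s. s + c"]) auto

text \<open>
  The powers of \<open>z\<close> enter only through a homomorphism \<open>\<zeta>\<close> from the integers, because the identity is
  used both for the variable \<open>z\<close> and for \<open>z = 1\<close>. A new pair of factors is
  \<open>1 + q\<^bsup>2M+1\<^esup> - z q\<^sup>M - q\<^sup>M\<^sup>+\<^sup>1 / z\<close>; its terms fix \<open>s\<close> or shift it by one, and \<open>qbin_quot_pascal\<close> adds up the results.
\<close>
lemma finite_jacobi_triple_product:
  fixes \<zeta> :: "int \<Rightarrow> 'a::comm_ring_1 fps"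
  assumes \<zeta>0: "\<zeta> 0 = 1" and \<zeta>: "\<And>a b. \<zeta> (a + b) = \<zeta> a * \<zeta> b"
  shows "(\<Prod>m<M. (1 - \<zeta> 1 * fps_X ^ m) * (1 - \<zeta> (- 1) * fps_X ^ Suc m)) =
    qfac (2 * M) * (\<Sum>s = - int M..int M. alt_sign s * \<zeta> (- s) * qpow (tri s) * qbin_quot (int M) s)"
proof (induction M)
  case 0
  show ?case by (simp add: \<zeta>0 qbin_quot_def iqfac_int_def)
next
  case (Suc M)
  define f where "f s = alt_sign s * \<zeta> (- s) * qpow (tri s)" for s :: int
  define r :: "'a fps" where "r = qpow (2 * int M + 1)"
  let ?B = "qbin_quot (int M) :: int \<Rightarrow> 'a fps"
  let ?I = "{- int M..int M}" and ?I' = "{- int (Suc M)..int (Suc M)}"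
  have cancel: "\<zeta> 1 * \<zeta> (- 1) = 1"
    using \<zeta>[of 1 "- 1"] \<zeta>0 by simp
  have X: "fps_X ^ M = qpow (int M)" "fps_X ^ Suc M = qpow (int M + 1)"
    by (simp_all add: qpow_def nat_add_distrib)
  have XX: "qpow (int M) * qpow (int M + 1) = r"
    unfolding r_def by (subst qpow_add[symmetric]) (auto intro: arg_cong[where f = qpow])
  have "(1 - \<zeta> 1 * fps_X ^ M) * (1 - \<zeta> (- 1) * fps_X ^ Suc M)
      = 1 + (\<zeta> 1 * \<zeta> (- 1)) * (qpow (int M) * qpow (int M + 1))
        - \<zeta> 1 * qpow (int M) - \<zeta> (- 1) * qpow (int M + 1)"
    unfolding X by (simp add: algebra_simps)
  then have factor: "(1 - \<zeta> 1 * fps_X ^ M) * (1 - \<zeta> (- 1) * fps_X ^ Suc M)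
      = (1 + r) + (- \<zeta> 1 * qpow (int M)) + (- \<zeta> (- 1) * qpow (int M + 1))"
    by (simp add: cancel XX)
  have 1: "(1 + r) * (\<Sum>s\<in>?I. f s * ?B s) = (\<Sum>s\<in>?I'. f s * ((1 + r) * ?B s))"
    unfolding sum_distrib_left
    by (rule sum.mono_neutral_cong_left) (auto simp: qbin_quot_eq_0 algebra_simps)
  \<comment> \<open>Shifting \<open>s\<close> by one changes \<open>T\<^sub>s\<close> by \<open>- s\<close> or \<open>s + 1\<close>; this produces the weights in \<open>qbin_quot_pascal\<close>.\<close>
  have 2: "(- \<zeta> 1 * qpow (int M)) * (\<Sum>s\<in>?I. f s * ?B s)
      = (\<Sum>s\<in>?I'. f s * (qpow (int M + 1 + s) * ?B (s + 1)))"
  proof -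
    let ?h = "\<lambda>s. f s * (qpow (int M + 1 + s) * ?B (s + 1))"
    have "(- \<zeta> 1 * qpow (int M)) * (f s * ?B s) = ?h (s + (- 1))" if "s \<in> ?I" for s
    proof -
      have "qpow (tri (s - 1)) * qpow (int M + s) = (qpow (tri s) * qpow (int M) :: 'a fps)"
        using that tri_ge(1)[of s] by (subst (1 2) qpow_add[symmetric]) (auto simp: tri_minus_1)
      moreover have "\<zeta> (- (s - 1)) = \<zeta> (- s) * \<zeta> 1"
        using \<zeta>[of "- s" 1] by simp
      ultimately show ?thesis
        by (simp add: f_def mult_ac)
    qed
    then have "(- \<zeta> 1 * qpow (int M)) * (\<Sum>s\<in>?I. f s * ?B s) = (\<Sum>s\<in>?I. ?h (s + (- 1)))"
      unfolding sum_distrib_left by (intro sum.cong) auto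
    also have "\<dots> = (\<Sum>s\<in>?I'. ?h s)"
      unfolding sum_shift_int[of ?h "- 1"]
          by (rule sum.mono_neutral_left) (auto simp: qbin_quot_eq_0)
    finally show ?thesis .
  qed
  have 3: "(- \<zeta> (- 1) * qpow (int M + 1)) * (\<Sum>s\<in>?I. f s * ?B s)
      = (\<Sum>s\<in>?I'. f s * (qpow (int M + 1 - s) * ?B (s - 1)))"
  proof -
    let ?h = "\<lambda>s. f s * (qpow (int M + 1 - s) * ?B (s - 1))"
    have "(- \<zeta> (- 1) * qpow (int M + 1)) * (f s * ?B s) = ?h (s + 1)" if "s \<in> ?I" for s
    proof -
      have "qpow (tri (s + 1)) * qpow (int M - s) = (qpow (tri s) * qpow (int M + 1) :: 'a fps)"
        using that tri_ge(2)[of s] by (subst (1 2) qpow_add[symmetric])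
            (auto simp: tri_plus_1 intro!: arg_cong[where f = qpow])
      moreover have "\<zeta> (- (s + 1)) = \<zeta> (- s) * \<zeta> (- 1)"
        using \<zeta>[of "- s" "- 1"] by simp
      ultimately show ?thesis
        by (simp add: f_def mult_ac)
    qed
    then have "(- \<zeta> (- 1) * qpow (int M + 1)) * (\<Sum>s\<in>?I. f s * ?B s) = (\<Sum>s\<in>?I. ?h (s + 1))"
      unfolding sum_distrib_left by (intro sum.cong) auto
    also have "\<dots> = (\<Sum>s\<in>?I'. ?h s)"
      unfolding sum_shift_int[of ?h 1] by (rule sum.mono_neutral_left) (auto simp: qbin_quot_eq_0)
    finally show ?thesis .
  qed
  have pascal: "f s * ((1 + r) * ?B s) + f s * (qpow (int M + 1 + s) * ?B (s + 1))
        + f s * (qpow (int M + 1 - s) * ?B (s - 1))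
      = (1 - r) * (1 - qpow (2 * int M + 2)) * (f s * qbin_quot (int (Suc M)) s)" if "s \<in> ?I'" for s
  proof -
    have "(1 - r) * (1 - qpow (2 * int M + 2)) * qbin_quot (int (Suc M)) s =
        (1 + r) * ?B s + qpow (int M + 1 - s) * ?B (s - 1) + qpow (int M + 1 + s) * ?B (s + 1)"
      using qbin_quot_pascal[of "int M" s, where 'a = 'a] that by (auto simp: r_def add.commute)
    then have "f s * ((1 - r) * (1 - qpow (2 * int M + 2)) * qbin_quot (int (Suc M)) s) =
        f s * ((1 + r) * ?B s + qpow (int M + 1 - s) * ?B (s - 1)
            + qpow (int M + 1 + s) * ?B (s + 1))"
      by simp
    then show ?thesis
      by (simp only: distrib_left mult_ac add_ac)
  qed
  have split: "((1 + r) + (- \<zeta> 1 * qpow (int M)) + (- \<zeta> (- 1) * qpow (int M + 1))) * S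
      = (1 + r) * S + (- \<zeta> 1 * qpow (int M)) * S + (- \<zeta> (- 1) * qpow (int M + 1)) * S" for S
    by (simp only: distrib_right)
  have "(\<Prod>m<Suc M. (1 - \<zeta> 1 * fps_X ^ m) * (1 - \<zeta> (- 1) * fps_X ^ Suc m))
      = qfac (2 * M) * (((1 + r) + (- \<zeta> 1 * qpow (int M)) + (- \<zeta> (- 1) * qpow (int M + 1)))
          * (\<Sum>s\<in>?I. f s * ?B s))"
    unfolding factor[symmetric] prod.lessThan_Suc Suc.IH f_def by (simp only: mult_ac)
  also have "\<dots> = qfac (2 * M) * (\<Sum>s\<in>?I'. (1 - r) * (1 - qpow (2 * int M + 2))
      * (f s * qbin_quot (int (Suc M)) s))"
    unfolding split 1 2 3 sum.distrib[symmetric]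
    by (intro arg_cong2[where f = "(*)"] sum.cong refl pascal)
  also have "\<dots> = (qfac (2 * M) * ((1 - r) * (1 - qpow (2 * int M + 2))))
      * (\<Sum>s\<in>?I'. f s * qbin_quot (int (Suc M)) s)"
    by (simp only: sum_distrib_left mult.assoc)
  also have "qfac (2 * M) * ((1 - r) * (1 - qpow (2 * int M + 2))) = qfac (2 * Suc M)"
    by (simp add: r_def qpow_def nat_add_distrib nat_mult_distrib mult_ac)
  finally show ?case
    by (simp only: f_def)
qed

text \<open>At \<open>z = 1\<close> the finite triple product contains the factor \<open>1 - z = 0\<close>.\<close>
lemma alternating_qbin_quot_sum:
  assumes "0 < M"
  shows "(\<Sum>s = - int M..int M. alt_sign s * qpow (tri s) * qbin_quot (int M) s)
      = (0 :: 'a::comm_ring_1 fps)"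
proof -
  let ?S = "\<Sum>s = - int M..int M. alt_sign s * qpow (tri s) * qbin_quot (int M) s :: 'a fps"
  have "qfac (2 * M) * ?S = (\<Prod>m<M. (1 - fps_X ^ m) * (1 - fps_X ^ Suc m))"
    using finite_jacobi_triple_product[of "\<lambda>_. 1 :: 'a fps" M] by simp
  also have "\<dots> = 0"
    using assms by (intro prod_zero bexI[of _ 0]) simp_all
  finally have "iqfac (2 * M) * qfac (2 * M) * ?S = 0"
    by (simp only: mult.assoc mult_zero_right)
  then show ?thesis
    by (simp add: iqfac_qfac)
qed

text \<open>
  The finite triple product with \<open>M = N + 1\<close>, multiplied by \<open>(q)\<^sub>N\<close>. The terms outside \<open>- N - 1 \<le> s \<le> N\<close>
  vanish modulo \<open>q\<^sup>N\<^sup>+\<^sup>1\<close>, so the sum may be taken over any larger set; this freedom is needed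
  when the index of summation is shifted.
\<close>
lemma jacobi_triple_product_congr:
  fixes \<zeta> :: "int \<Rightarrow> 'a::comm_ring_1 fps"
  assumes \<zeta>0: "\<zeta> 0 = 1" and \<zeta>: "\<And>a b. \<zeta> (a + b) = \<zeta> a * \<zeta> b"
    and S: "finite S" "{- int N - 1..int N} \<subseteq> S"
  shows "congr (fps_X ^ Suc N)
    (qfac N * ((1 - \<zeta> 1) * (\<Prod>m<N. (1 - \<zeta> 1 * fps_X ^ Suc m) * (1 - \<zeta> (- 1) * fps_X ^ Suc m))))
    (\<Sum>s\<in>S. alt_sign s * \<zeta> (- s) * qpow (tri s))"
proof -
  let ?q = "fps_X ^ Suc N :: 'a fps"
  let ?D = "\<Prod>m<N. (1 - \<zeta> 1 * fps_X ^ Suc m) * (1 - \<zeta> (- 1) * fps_X ^ Suc m)"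
  let ?I = "{- int (Suc N)..int (Suc N)}"
  let ?f = "\<lambda>s. alt_sign s * \<zeta> (- s) * qpow (tri s) :: 'a fps"
  have q: "?q = qpow (int N + 1)"
    by (simp add: qpow_def nat_add_distrib)
  have small: "?q dvd ?f s" if "s \<notin> {- int N - 1..int N}" for s
    unfolding q using that tri_ge[of s] by (intro dvd_mult qpow_dvd) auto
  have "(\<Prod>m<Suc N. (1 - \<zeta> 1 * fps_X ^ m) * (1 - \<zeta> (- 1) * fps_X ^ Suc m))
      = ((1 - \<zeta> 1) * ?D) * (1 - \<zeta> (- 1) * ?q)"
    unfolding prod.distrib
    by (subst prod.lessThan_Suc_shift, subst prod.lessThan_Suc) (simp add: mult_ac)
  then have jac: "((1 - \<zeta> 1) * ?D) * (1 - \<zeta> (- 1) * ?q)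
      = qfac (2 * Suc N) * (\<Sum>s\<in>?I. ?f s * qbin_quot (int (Suc N)) s)"
    using finite_jacobi_triple_product[OF \<zeta>0 \<zeta>, of "Suc N"] by (simp only:)
  have "congr ?q (qfac N * (((1 - \<zeta> 1) * ?D) * 1))
      (qfac N * (((1 - \<zeta> 1) * ?D) * (1 - \<zeta> (- 1) * ?q)))"
    by (intro congr_mult congr_refl) (simp add: congr_def)
  also have "qfac N * (((1 - \<zeta> 1) * ?D) * (1 - \<zeta> (- 1) * ?q))
      = (\<Sum>s\<in>?I. ?f s * (qfac N * (qfac (2 * Suc N) * qbin_quot (int (Suc N)) s)))"
    unfolding jac sum_distrib_left by (intro sum.cong refl) (simp only: mult_ac)
  also have "congr ?q \<dots> (\<Sum>s\<in>?I. ?f s * 1)"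
  proof (rule congr_sum)
    fix s assume s: "s \<in> ?I"
    \<comment> \<open>For large \<open>|s|\<close> the weight is \<open>1\<close> only modulo a low power \<open>q\<^sup>r\<close>; since \<open>T\<^sub>s \<ge> |s| - 1\<close>,
      the factor \<open>q\<^bsup>T\<^sub>s\<^esup>\<close> makes up for it.\<close>
    define r where "r = min (int N + 1) (int N + 2 - \<bar>s\<bar>)"
    have "0 \<le> r" using s by (auto simp: r_def)
    have "int N + 1 \<le> tri s + r"
    proof -
      have "0 \<le> (\<bar>s\<bar> - 1) * (\<bar>s\<bar> - 2)"
        by (cases "\<bar>s\<bar> \<le> 1") (auto intro: mult_nonneg_nonneg mult_nonpos_nonpos)
      then have "2 * (\<bar>s\<bar> - 1) \<le> 2 * tri s"
        unfolding tri_double by (auto simp: abs_if algebra_simps split: if_splits)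
      then show ?thesis
        using tri_nonneg[of s] by (simp add: r_def min_def)
    qed
    then have "?q dvd qpow (tri s) * qpow r"
      unfolding q using \<open>0 \<le> r\<close> by (subst qpow_add[symmetric]) (auto intro: qpow_dvd)
    then show "congr ?q (?f s * (qfac N * (qfac (2 * Suc N) * qbin_quot (int (Suc N)) s)))
        (?f s * 1)"
      using s by (intro congr_mult_dvd[of "qpow r" _ _ "qpow (tri s)"] qbin_quot_congr)
          (auto simp: r_def)
  qed
  also have "congr ?q (\<Sum>s\<in>?I. ?f s * 1) (\<Sum>s\<in>S. ?f s)"
  proof -
    have *: "congr ?q (sum ?f T) (sum ?f {- int N - 1..int N})"
      if "finite T" "{- int N - 1..int N} \<subseteq> T" for T
    proof -
      have "sum ?f T - sum ?f {- int N - 1..int N} = sum ?f (T - {- int N - 1..int N})"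
        using that by (simp add: sum_diff)
      then show ?thesis
        using small by (auto simp: congr_def intro!: dvd_sum simp del: power_Suc)
    qed
    show ?thesis
      using congr_trans[OF *[of ?I] congr_sym[OF *[of S]]] S by simp
  qed
  finally show ?thesis
    by (simp only: mult_1_right)
qed

section \<open>Multiplicities of irreducible characters\<close>

text \<open>
  The coefficient of \<open>t\<^sup>k\<close> in \<open>(t - 1/t) (t + 1/t)\<^sup>r\<close>. For \<open>k = 0\<close> it is \<open>0\<close> since this Laurent polynomial changes
  sign under \<open>t \<mapsto> 1/t\<close>; for \<open>k \<ge> 1\<close> the recursion multiplies by \<open>t + 1/t\<close> and stays among natural numbers.
\<close>
fun ballot :: "nat \<Rightarrow> nat \<Rightarrow> nat" where
  "ballot 0 k = (if k = 1 then 1 else 0)"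
| "ballot (Suc r) k = (if k = 0 then 0 else ballot r (k - 1) + ballot r (k + 1))"

lemma ballot_0_right [simp]: "ballot r 0 = 0"
  by (cases r) auto

text \<open>
  The coefficient of \<open>t\<^sup>k\<close> in \<open>(t - 1/t) p(t + 1/t)\<close>: the multiplicity of the irreducible character
  \<open>(t\<^sup>k - t\<^bsup>-k\<^esup>) / (t - 1/t)\<close> of \<open>SL\<^sub>2\<close> in \<open>p\<close>.
\<close>
definition sl2_mult :: "nat \<Rightarrow> 'a::comm_ring_1 poly \<Rightarrow> 'a" where
  "sl2_mult k p = (\<Sum>r\<le>degree p. coeff p r * of_nat (ballot r k))"

lemma sl2_mult_alt:
  assumes "degree p \<le> d"
  shows "sl2_mult k p = (\<Sum>r\<le>d. coeff p r * of_nat (ballot r k))"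
  unfolding sl2_mult_def using assms by (intro sum.mono_neutral_left) (auto simp: coeff_eq_0)

lemma sl2_mult_0_left [simp]: "sl2_mult 0 p = 0"
  by (simp add: sl2_mult_def)

lemma sl2_mult_0 [simp]: "sl2_mult k 0 = 0"
  by (simp add: sl2_mult_def)

lemma sl2_mult_const [simp]: "sl2_mult k [:a:] = (if k = 1 then a else 0)"
  by (simp add: sl2_mult_def)

lemma sl2_mult_add: "sl2_mult k (p + r) = sl2_mult k p + sl2_mult k r"
proof -
  let ?d = "max (degree p) (degree r)"
  have "degree (p + r) \<le> ?d" by (rule degree_add_le) auto
  then show ?thesis
    by (simp add: sl2_mult_alt[of _ ?d] distrib_right sum.distrib)
qed

lemma sl2_mult_smult: "sl2_mult k (smult a p) = a * sl2_mult k p"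
  by (simp add: sl2_mult_alt[of _ "degree p"] degree_smult_le sum_distrib_left mult.assoc)

lemma sl2_mult_diff: "sl2_mult k (p - r) = sl2_mult k p - sl2_mult k r"
  using sl2_mult_add[of k "p - r" r] by simp

lemma sl2_mult_sum: "sl2_mult k (sum f S) = (\<Sum>s\<in>S. sl2_mult k (f s))"
  by (induction S rule: infinite_finite_induct) (auto simp: sl2_mult_add)

text \<open>
  The Clebsch-Gordan rule for the tensor product with the two-dimensional representation.
\<close>
lemma sl2_mult_pCons_0:
  assumes "0 < k"
  shows "sl2_mult k (pCons 0 p) = sl2_mult (k - 1) p + sl2_mult (k + 1) p"
proof -
  have "sl2_mult k (pCons 0 p) = (\<Sum>r\<le>Suc (degree p). coeff (pCons 0 p) r * of_nat (ballot r k))"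
    by (rule sl2_mult_alt) (rule degree_pCons_le)
  also have "\<dots> = (\<Sum>r\<le>degree p. coeff p r * of_nat (ballot (Suc r) k))"
    by (subst sum.atMost_Suc_shift) simp
  also have "\<dots> = sl2_mult (k - 1) p + sl2_mult (k + 1) p"
    using assms by (simp add: sl2_mult_def distrib_left sum.distrib)
  finally show ?thesis .
qed

section \<open>The interpolation polynomials\<close>

text \<open>
  The polynomial \<open>(1 + t q\<^sup>m) (1 + q\<^sup>m / t)\<close> in \<open>c = t + 1/t\<close>. It equals \<open>q\<^sup>m (c + q\<^sup>m + q\<^bsup>-m\<^esup>)\<close>, and \<open>g_factor 0\<close> is \<open>c + 2\<close>.
\<close>
definition g_factor :: "nat \<Rightarrow> 'a::comm_ring_1 fps poly" where
  "g_factor m = [:1 + fps_X ^ (2 * m), fps_X ^ m:]"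

definition F_prod :: "nat \<Rightarrow> 'a::comm_ring_1 fps poly" where
  "F_prod N = (\<Prod>m = 1..N. g_factor m)"

definition F_omit :: "nat \<Rightarrow> nat \<Rightarrow> 'a::comm_ring_1 fps poly" where
  "F_omit N s = (\<Prod>m \<in> {1..N} - {s}. g_factor m)"

text \<open>
  The quotient of \<open>F_prod N - (q)\<^sub>N\<^sup>2\<close> by \<open>c + 2\<close>, see \<open>g_factor_0_mult_F_quot\<close>. The recursion, which avoids
  division, rests on \<open>g\<^sub>m = q\<^sup>m (c + 2) + (1 - q\<^sup>m)\<^sup>2\<close>.
\<close>
primrec F_quot :: "nat \<Rightarrow> 'a::comm_ring_1 fps poly" where
  "F_quot 0 = 0"
| "F_quot (Suc N) = smult ((1 - fps_X ^ Suc N)\<^sup>2) (F_quot N) + smult (fps_X ^ Suc N) (F_prod N)"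

text \<open>
  For \<open>0 < |s| \<le> N\<close> this is \<open>F_prod N\<close> divided by \<open>c + q\<^sup>s + q\<^bsup>-s\<^esup>\<close>. At \<open>s = 0\<close> the divisor \<open>c + 2\<close> is not a factor of
  \<open>F_prod N\<close>, and the value \<open>(q)\<^sub>N\<^sup>2\<close> of \<open>F_prod N\<close> at \<open>c = -2\<close> has to be subtracted first.
\<close>
definition node_poly :: "nat \<Rightarrow> int \<Rightarrow> 'a::comm_ring_1 fps poly" where
  "node_poly N s = (if s = 0 then F_quot N else smult (qpow \<bar>s\<bar>) (F_omit N (nat \<bar>s\<bar>)))"

lemma sl2_mult_g_factor_mult:
  assumes "0 < k"
  shows "sl2_mult k (g_factor m * p)
      = (1 + fps_X ^ (2 * m)) * sl2_mult k p
          + fps_X ^ m * (sl2_mult (k - 1) p + sl2_mult (k + 1) p)"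
  using assms by (simp add: g_factor_def sl2_mult_add sl2_mult_smult sl2_mult_pCons_0 distrib_left)

lemma F_prod_0 [simp]: "F_prod 0 = 1"
  by (simp add: F_prod_def)

lemma F_prod_Suc: "F_prod (Suc N) = g_factor (Suc N) * F_prod N"
  by (simp add: F_prod_def mult.commute)

lemma g_factor_mult_F_omit: "1 \<le> s \<Longrightarrow> s \<le> N \<Longrightarrow> g_factor s * F_omit N s = F_prod N"
  unfolding F_prod_def F_omit_def by (simp add: prod.remove)

lemma F_omit_Suc: "s \<le> N \<Longrightarrow> F_omit (Suc N) s = g_factor (Suc N) * F_omit N s"
proof -
  assume "s \<le> N"
  then have "{1..Suc N} - {s} = insert (Suc N) ({1..N} - {s})" by auto
  then show ?thesis by (simp add: F_omit_def)
qed

lemma F_omit_Suc_self: "F_omit (Suc N) (Suc N) = F_prod N"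
proof -
  have "{1..Suc N} - {Suc N} = {1..N}" by auto
  then show ?thesis by (simp add: F_omit_def F_prod_def)
qed

lemma g_factor_0_mult_F_quot: "g_factor 0 * F_quot N = F_prod N - [:(qfac N)\<^sup>2:]"
proof (induction N)
  case (Suc N)
  let ?x = "fps_X ^ Suc N :: 'a fps"
  have g: "g_factor (Suc N) = smult ?x (g_factor 0) + [:(1 - ?x)\<^sup>2:]"
  proof -
    define x where "x = ?x"
    have "fps_X ^ (2 * Suc N) = x * x"
      unfolding x_def mult_2 power_add ..
    then show ?thesis
      unfolding g_factor_def x_def[symmetric]
          by (simp only:) (simp add: power2_eq_square algebra_simps)
  qed
  have "g_factor 0 * F_quot (Suc N)
      = smult ((1 - ?x)\<^sup>2) (g_factor 0 * F_quot N) + smult ?x (g_factor 0) * F_prod N"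
    by (simp add: algebra_simps del: power_Suc)
  also have "\<dots> = F_prod (Suc N) - [:(qfac (Suc N))\<^sup>2:]"
  proof -
    have "[:(qfac (Suc N))\<^sup>2:] = smult ((1 - ?x)\<^sup>2) [:(qfac N)\<^sup>2:]"
      by (simp add: power_mult_distrib del: power_Suc)
    then show ?thesis
      unfolding Suc.IH F_prod_Suc g by (simp add: distrib_right smult_diff_right del: power_Suc qfac_simps)
  qed
  finally show ?case .
qed (simp add: g_factor_def one_pCons)

text \<open>
  For \<open>m = N + 1\<close> this is \<open>q\<^sup>m (c + q\<^sup>m + q\<^bsup>-m\<^esup>) - q\<^sup>m (c + q\<^sup>s + q\<^bsup>-s\<^esup>) = (1 - q\<^bsup>m+s\<^esup>) (1 - q\<^bsup>m-s\<^esup>)\<close>, with the second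
  term on the left rewritten as a multiple of \<open>g\<^sub>s\<close>.
\<close>
lemma g_factor_difference:
  assumes "s \<le> Suc N"
  shows "g_factor (Suc N) - [:(1 - qpow (int N + 1 + int s)) * (1 - qpow (int N + 1 - int s)):]
    = smult (qpow (int N + 1 - int s)) (g_factor s)"
proof -
  have 1: "qpow (int N + 1 + int s) * qpow (int N + 1 - int s) = (fps_X ^ (2 * Suc N) :: 'a fps)"
    "qpow (int N + 1 - int s) * fps_X ^ s = (fps_X ^ Suc N :: 'a fps)"
    "qpow (int N + 1 - int s) * fps_X ^ (2 * s) = (qpow (int N + 1 + int s) :: 'a fps)"
  proof -
    have "nat (int N + 1 + int s) = Suc N + s" "nat (int N + 1 - int s) = Suc N - s"
      using assms by linarith+
    then have "nat (int N + 1 + int s) + nat (int N + 1 - int s) = 2 * Suc N"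
      "nat (int N + 1 - int s) + s = Suc N" "nat (int N + 1 - int s) + 2 * s
          = nat (int N + 1 + int s)"
      using assms by simp_all
    then show "qpow (int N + 1 + int s) * qpow (int N + 1 - int s)
        = (fps_X ^ (2 * Suc N) :: 'a fps)"
      "qpow (int N + 1 - int s) * fps_X ^ s = (fps_X ^ Suc N :: 'a fps)"
      "qpow (int N + 1 - int s) * fps_X ^ (2 * s) = (qpow (int N + 1 + int s) :: 'a fps)"
      by (simp_all only: qpow_def power_add[symmetric])
  qed
  have "smult (qpow (int N + 1 - int s)) (g_factor s)
      = [:qpow (int N + 1 - int s) + qpow (int N + 1 + int s), fps_X ^ Suc N :: 'a fps:]"
    by (simp add: g_factor_def distrib_left 1 del: power_Suc)
  then show ?thesis
    unfolding g_factor_def 1(1)[symmetric] by (simp only:) (simp add: algebra_simps)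
qed

text \<open>
  An interpolation identity: multiplied by \<open>(q)\<^bsub>2N\<^esub> (c + 2)\<close>, and with the correction at \<open>s = 0\<close> moved to the
  other side, it expresses a constant through its values at the nodes \<open>c = - q\<^sup>s - q\<^bsup>-s\<^esup>\<close> with
  \<open>0 \<le> s \<le> N\<close>. It is proved by induction on \<open>N\<close>. By \<open>g_factor_difference\<close>, replacing \<open>N\<close> by \<open>N + 1\<close> changes the
  summand by \<open>q\<^sup>N\<^sup>+\<^sup>1 F_prod N\<close> times the summand of \<open>alternating_qbin_quot_sum\<close>, so the changes add up to zero.
\<close>
lemma qbin_quot_node_poly_sum:
  "(\<Sum>s = - int N..int N. smult (alt_sign s * qpow (tri s) * qbin_quot (int N) s) (node_poly N s))
    = (0 :: 'a::comm_ring_1 fps poly)"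
proof (induction N)
  case (Suc N)
  let ?I = "{- int N..int N}" and ?I' = "{- int (Suc N)..int (Suc N)}"
  let ?c = "\<lambda>s. alt_sign s * qpow (tri s) :: 'a fps"
  let ?P = "\<lambda>s. (1 - qpow (int N + 1 + s)) * (1 - qpow (int N + 1 - s)) :: 'a fps"
  have step: "node_poly (Suc N) s = smult (?P s) (node_poly N s) + smult (fps_X ^ Suc N) (F_prod N)"
    if "s \<in> ?I'" for s
  proof -
    define a where "a = nat \<bar>s\<bar>"
    have P: "?P s = ?P (int a)"
      by (cases "s \<ge> 0") (auto simp: a_def)
    have a: "a \<le> Suc N" using that by (auto simp: a_def)
    consider "s = 0" | "a = Suc N" | "1 \<le> a" "a \<le> N"
    proof -
      have "s = 0 \<or> a = Suc N \<or> 1 \<le> a \<and> a \<le> N"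
        using a unfolding a_def by arith
      then show ?thesis
        using that by blast
    qed
    then show ?thesis
    proof cases
      case 1
      then show ?thesis
        by (simp add: node_poly_def power2_eq_square qpow_def nat_add_distrib)
    next
      case 2
      then have "s \<noteq> 0" "\<bar>s\<bar> = int (Suc N)" by (auto simp: a_def)
      then show ?thesis
        unfolding P by (simp add: node_poly_def 2 F_omit_Suc_self qpow_def nat_add_distrib del: of_nat_Suc)
    next
      case 3
      then have s: "s \<noteq> 0" "\<bar>s\<bar> = int a" by (auto simp: a_def)
      have "g_factor (Suc N) * F_omit N a
          = smult (?P (int a)) (F_omit N a)
              + smult (qpow (int N + 1 - int a)) (g_factor a) * F_omit N a"
        using g_factor_difference[OF a, where 'a = 'a] by (simp add: algebra_simps)
      also have "smult (qpow (int N + 1 - int a)) (g_factor a) * F_omit N a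
          = smult (qpow (int N + 1 - int a)) (F_prod N :: 'a fps poly)"
        using 3 by (simp add: g_factor_mult_F_omit)
      finally have "smult (qpow (int a)) (g_factor (Suc N) * F_omit N a)
          = smult (?P (int a)) (smult (qpow (int a)) (F_omit N a))
          + smult (qpow (int a) * qpow (int N + 1 - int a)) (F_prod N)"
        by (simp add: smult_add_right mult.commute)
      moreover have "qpow (int a) * qpow (int N + 1 - int a) = (fps_X ^ Suc N :: 'a fps)"
        using 3 by (subst qpow_add[symmetric]) (auto simp: qpow_def nat_add_distrib)
      ultimately show ?thesis
        unfolding P using s 3 by (simp add: node_poly_def F_omit_Suc)
    qed
  qed
  have "(\<Sum>s\<in>?I'. smult (?c s * qbin_quot (int (Suc N)) s) (node_poly (Suc N) s))
      = (\<Sum>s\<in>?I'. smult (?c s * qbin_quot (int N) s) (node_poly N s)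
          + smult (?c s * qbin_quot (int (Suc N)) s) (smult (fps_X ^ Suc N) (F_prod N)))"
  proof (intro sum.cong refl)
    fix s assume s: "s \<in> ?I'"
    have "qbin_quot (int N) s = ?P s * (qbin_quot (int (Suc N)) s :: 'a fps)"
      using qbin_quot_step[of s "int N", where 'a = 'a] s by (auto simp: add.commute)
    then show "smult (?c s * qbin_quot (int (Suc N)) s) (node_poly (Suc N) s)
        = smult (?c s * qbin_quot (int N) s) (node_poly N s)
          + smult (?c s * qbin_quot (int (Suc N)) s) (smult (fps_X ^ Suc N) (F_prod N))"
      unfolding step[OF s] by (simp only: smult_add_right smult_smult mult_ac)
  qed
  also have "\<dots> = (\<Sum>s\<in>?I'. smult (?c s * qbin_quot (int N) s) (node_poly N s))
      + smult (\<Sum>s\<in>?I'. ?c s * qbin_quot (int (Suc N)) s) (smult (fps_X ^ Suc N) (F_prod N))"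
    by (simp only: sum.distrib smult_sum)
  also have "(\<Sum>s\<in>?I'. smult (?c s * qbin_quot (int N) s) (node_poly N s))
      = (\<Sum>s\<in>?I. smult (?c s * qbin_quot (int N) s) (node_poly N s))"
    by (rule sum.mono_neutral_right) (auto simp: qbin_quot_eq_0)
  also have "(\<Sum>s\<in>?I'. ?c s * qbin_quot (int (Suc N)) s) = 0"
    by (rule alternating_qbin_quot_sum) simp
  finally show ?case
    using Suc.IH by simp
qed (simp add: node_poly_def)

section \<open>Moments of the multiplicities\<close>

text \<open>
  Up to the sign \<open>(-1)\<^sup>i\<close>, the coefficient of \<open>z\<^bsup>-i\<^esup>\<close> in the product of the theta series
  \<open>\<Sum>\<^sub>j (-1)\<^sup>j q\<^bsup>T\<^sub>j\<^esup> z\<^bsup>-j\<^esup>\<close> and \<open>\<Sum>\<^sub>s z\<^sup>s sl2_mult k (node_poly N s)\<close>.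
\<close>
definition moment :: "nat \<Rightarrow> nat \<Rightarrow> int \<Rightarrow> 'a::comm_ring_1 fps" where
  "moment N k i = (\<Sum>s = - int N..int N. alt_sign s * qpow (tri (i + s))
      * sl2_mult k (node_poly N s))"

lemma qpow_dvd_sl2_mult_node_poly: "qpow \<bar>s\<bar> dvd sl2_mult k (node_poly N s)"
  by (auto simp: node_poly_def sl2_mult_smult)

text \<open>
  Since \<open>node_poly N s\<close> carries the factor \<open>q\<^bsup>|s|\<^esup>\<close>, the weights \<open>qbin_quot N s\<close> in \<open>qbin_quot_node_poly_sum\<close> may be
  replaced by a constant, up to an error of order \<open>q\<^sup>N\<^sup>+\<^sup>1\<close>.
\<close>
lemma moment_0_congr: "congr (fps_X ^ Suc N) (moment N k 0) 0"
proof -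
  let ?q = "fps_X ^ Suc N :: 'a fps"
  have q: "?q = qpow (int N + 1)"
    by (simp add: qpow_def nat_add_distrib)
  have "congr ?q (\<Sum>s = - int N..int N. alt_sign s * qpow (tri s) * sl2_mult k (node_poly N s) * 1)
      (\<Sum>s = - int N..int N. alt_sign s * qpow (tri s) * sl2_mult k (node_poly N s)
          * (qfac N * (qfac (2 * N) * qbin_quot (int N) s)))"
  proof (rule congr_sum)
    fix s assume s: "s \<in> {- int N..int N}"
    have dvd: "?q dvd qpow \<bar>s\<bar> * qpow (int N - \<bar>s\<bar> + 1)"
      unfolding q using s by (subst qpow_add[symmetric]) (auto intro: qpow_dvd)
    show "congr ?q (alt_sign s * qpow (tri s) * sl2_mult k (node_poly N s) * 1)
        (alt_sign s * qpow (tri s) * sl2_mult k (node_poly N s)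
            * (qfac N * (qfac (2 * N) * qbin_quot (int N) s)))"
      using s by (intro congr_mult_dvd[OF congr_sym[OF qbin_quot_congr] _ dvd] dvd_mult qpow_dvd_sl2_mult_node_poly) auto
  qed
  also have "(\<Sum>s = - int N..int N. alt_sign s * qpow (tri s) * sl2_mult k (node_poly N s)
      * (qfac N * (qfac (2 * N) * qbin_quot (int N) s)))
      = qfac N * (qfac (2 * N) * sl2_mult k (\<Sum>s
          = - int N..int N. smult (alt_sign s * qpow (tri s) * qbin_quot (int N) s)
              (node_poly N s)))"
    by (simp only: sl2_mult_sum sl2_mult_smult sum_distrib_left mult_ac)
  also have "\<dots> = 0"
    by (simp only: qbin_quot_node_poly_sum sl2_mult_0 mult_zero_right)
  finally show ?thesis
    by (simp add: moment_def)
qed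

lemma node_poly_uminus [simp]: "node_poly N (- s) = node_poly N s"
  by (simp add: node_poly_def)

lemma moment_reflect: "moment N k (- 1 - i) = moment N k i"
proof -
  have "moment N k (- 1 - i) = (\<Sum>s
      = - int N..int N. alt_sign (- s) * qpow (tri (i + - s)) * sl2_mult k (node_poly N (- s)))"
    unfolding moment_def
  proof (intro sum.cong refl)
    fix s
    have "- 1 - i + s = - 1 - (i + - s)" by simp
    then show "alt_sign s * qpow (tri (- 1 - i + s)) * sl2_mult k (node_poly N s)
        = alt_sign (- s) * qpow (tri (i + - s)) * sl2_mult k (node_poly N (- s))"
      by (simp only: tri_reflect alt_sign_simps node_poly_uminus)
  qed
  also have "\<dots> = moment N k i"
    unfolding moment_def by (rule sum.reindex_bij_witness[where i = uminus and j = uminus]) auto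
  finally show ?thesis .
qed

text \<open>
  The reflection \<open>i + s \<mapsto> - 1 - i - s\<close> preserves the triangular number and changes the sign, so
  only the terms whose reflections leave the range of summation survive; their exponents are at least
  \<open>N - i\<close>.
\<close>
lemma qpow_dvd_alternating_sum:
  assumes "0 \<le> i"
  shows "qpow (int N - i) dvd (\<Sum>s
      = - int N..int N. alt_sign s * qpow (tri (i + s)) :: 'a::comm_ring_1 fps)"
proof (cases "i < int N")
  case True
  let ?g = "\<lambda>s. alt_sign s * qpow (tri (i + s)) :: 'a fps"
  have reflect: "(\<Sum>s = - 2 * i - 1 - int N..- i - 1. ?g s) = (\<Sum>s = - i..int N. - ?g s)"
  proof (rule sum.reindex_bij_witness[where i = "\<lambda>s. - 2 * i - 1 - s" and j = "\<lambda>s. - 2 * i - 1 - s"])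
    fix s
    have "i + (- 2 * i - 1 - s) = - 1 - (i + s)" by simp
    then have "tri (i + (- 2 * i - 1 - s)) = tri (i + s)"
      by (simp only: tri_reflect)
    moreover have "alt_sign (- 2 * i - 1 - s) = - (alt_sign s :: 'a fps)"
      by (auto simp: alt_sign_def)
    ultimately show "- ?g (- 2 * i - 1 - s) = ?g s"
      by simp
  qed auto
  \<comment> \<open>The range is first enlarged to one that is symmetric under the reflection.\<close>
  have split: "sum ?g {- 2 * i - 1 - int N..int N}
      = sum ?g {- 2 * i - 1 - int N..- int N - 1} + sum ?g {- int N..int N}"
    using assms by (subst sum.union_disjoint[symmetric]) (auto intro!: arg_cong[where f = "sum ?g"])
  have "sum ?g {- 2 * i - 1 - int N..int N}
      = sum ?g {- 2 * i - 1 - int N..- i - 1} + sum ?g {- i..int N}"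
    using assms True by (subst sum.union_disjoint[symmetric])
        (auto intro!: arg_cong[where f = "sum ?g"])
  also have "\<dots> = 0"
    unfolding reflect by (simp add: sum_negf)
  finally have "sum ?g {- int N..int N} = - sum ?g {- 2 * i - 1 - int N..- int N - 1}"
    unfolding split by (simp add: eq_neg_iff_add_eq_0 add.commute)
  moreover have "qpow (int N - i) dvd sum ?g {- 2 * i - 1 - int N..- int N - 1}"
  proof (intro dvd_sum dvd_mult qpow_dvd)
    fix s assume "s \<in> {- 2 * i - 1 - int N..- int N - 1}"
    then show "int N - i \<le> tri (i + s)"
      using tri_ge(2)[of "i + s"] by auto
  qed
  ultimately show ?thesis
    by simp
qed (simp add: qpow_def)

text \<open>
  By \<open>T\<^bsub>j+1\<^esub> = T\<^sub>j + j + 1\<close> and \<open>T\<^bsub>j-1\<^esub> = T\<^sub>j - j\<close>, the terms of the moment for \<open>i + 1\<close>, and those for \<open>i - 1\<close>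
  times \<open>q\<^sup>2\<^sup>i\<^sup>+\<^sup>1\<close>, are the terms for \<open>i\<close> times \<open>q\<^sup>i\<^sup>+\<^sup>1\<close> times \<open>q\<^sup>s\<close>
      and \<open>q\<^bsup>-s\<^esup>\<close>. Together with the term for
  multiplication by \<open>c\<close> they contain \<open>(c + q\<^sup>s + q\<^bsup>-s\<^esup>) y\<^sub>s\<close>, which is \<open>F_prod N\<close>, or
  \<open>F_prod N - (q)\<^sub>N\<^sup>2\<close> if \<open>s = 0\<close>. As \<open>F_prod N\<close> does not depend on \<open>s\<close>, its total contribution is negligible
  by \<open>qpow_dvd_alternating_sum\<close>.
\<close>
lemma moment_recurrence:
  assumes i: "0 \<le> i" and k: "0 < k"
  shows "congr (fps_X ^ Suc N) (moment N k (i + 1))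
    (- (qpow (2 * i + 1) * moment N k (i - 1)
        + qpow (i + 1) * (moment N (k - 1) i + moment N (k + 1) i)
      + (if k = 1 then qpow (i + 1) * qpow (tri i) * (qfac N)\<^sup>2 else 0)))"
proof -
  let ?I = "{- int N..int N}"
  let ?\<delta> = "\<lambda>s. if s = 0 \<and> k = 1 then (qfac N)\<^sup>2 else 0 :: 'a fps"
  let ?A = "sl2_mult k (F_prod N) :: 'a fps"
  have pointwise: "qpow (tri (i + 1 + s)) * sl2_mult k (node_poly N s)
      + qpow (2 * i + 1) * (qpow (tri (i - 1 + s)) * sl2_mult k (node_poly N s))
      + qpow (i + 1) * (qpow (tri (i + s))
          * (sl2_mult (k - 1) (node_poly N s) + sl2_mult (k + 1) (node_poly N s)))
      = qpow (i + 1) * qpow (tri (i + s)) * (?A - ?\<delta> s)" if s: "s \<in> ?I" for s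
  proof -
    \<comment> \<open>The three terms have the exponents \<open>e + s\<close>, \<open>e - s\<close> and \<open>e\<close>.\<close>
    define e where "e = i + 1 + tri (i + s)"
    have e: "qpow (i + 1) * qpow (tri (i + s)) = (qpow e :: 'a fps)"
      unfolding e_def using i by (subst qpow_add) auto
    have t1: "tri (i + 1 + s) = e + s"
      using tri_plus_1[of "i + s"] by (simp add: e_def algebra_simps)
    have t2: "2 * i + 1 + tri (i - 1 + s) = e - s"
      using tri_minus_1[of "i + s"] by (simp add: e_def algebra_simps)
    have t2': "qpow (2 * i + 1) * qpow (tri (i - 1 + s)) = (qpow (e - s) :: 'a fps)"
      using i by (subst qpow_add[symmetric]) (auto simp: t2)
    have pos: "0 \<le> e + s" "0 \<le> e - s" "0 \<le> e"
      using tri_nonneg[of "i + 1 + s"] tri_nonneg[of "i - 1 + s"] tri_nonneg[of "i + s"] t1 t2 i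
      unfolding e_def by linarith+
    show ?thesis
    proof (cases "s = 0")
      case True
      have "sl2_mult k (g_factor 0 * F_quot N) = ?A - ?\<delta> s"
        using True by (simp add: g_factor_0_mult_F_quot sl2_mult_diff)
      then have "2 * sl2_mult k (F_quot N)
          + (sl2_mult (k - 1) (F_quot N) + sl2_mult (k + 1) (F_quot N)) = ?A - ?\<delta> s"
        using k by (simp add: sl2_mult_g_factor_mult)
      then have "qpow e * (2 * sl2_mult k (F_quot N)
          + (sl2_mult (k - 1) (F_quot N) + sl2_mult (k + 1) (F_quot N))) = qpow e * (?A - ?\<delta> s)"
        by simp
      then show ?thesis
        unfolding mult.assoc[symmetric] e t1 t2' using True
            by (simp add: node_poly_def algebra_simps)
    next
      case False
      define a where "a = nat \<bar>s\<bar>"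
      have a: "1 \<le> a" "a \<le> N" "\<bar>s\<bar> = int a"
        using False s by (auto simp: a_def)
      let ?h = "\<lambda>k. sl2_mult k (F_omit N a) :: 'a fps"
      have y: "sl2_mult k (node_poly N s) = qpow (int a) * ?h k" for k
        using False by (simp add: node_poly_def a(3) sl2_mult_smult)
      have "?A = sl2_mult k (g_factor a * F_omit N a)"
        using a by (simp add: g_factor_mult_F_omit)
      also have "\<dots> = (1 + qpow (2 * int a)) * ?h k + qpow (int a) * (?h (k - 1) + ?h (k + 1))"
        using k by (simp add: sl2_mult_g_factor_mult qpow_def nat_mult_distrib)
      finally have A: "?A - ?\<delta> s = (1 + qpow (2 * int a)) * ?h k
          + qpow (int a) * (?h (k - 1) + ?h (k + 1))"
        using False by simp
      have "qpow (e + s) * qpow (int a) + qpow (e - s) * qpow (int a)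
          = (qpow e * (1 + qpow (2 * int a)) :: 'a fps)"
      proof -
        have s_cases: "s = int a \<or> s = - int a"
          using a(3) by linarith
        then have "0 \<le> e - int a"
          using pos by auto
        then have "qpow (e - int a) * qpow (int a) = (qpow e :: 'a fps)"
          by (subst qpow_add[symmetric]) auto
        moreover have "qpow (e + int a) * qpow (int a) = (qpow e * qpow (2 * int a) :: 'a fps)"
          using pos(3) qpow_add[of "e + int a" "int a", where 'a = 'a] qpow_add[of e "2 * int a", where 'a = 'a]
          by (simp add: add.assoc)
        ultimately show ?thesis
          using s_cases by (auto simp: distrib_left)
      qed
      then have "(qpow (e + s) * qpow (int a) + qpow (e - s) * qpow (int a)) * ?h k
          + qpow e * qpow (int a) * (?h (k - 1) + ?h (k + 1)) = qpow e * (?A - ?\<delta> s)"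
        unfolding A by (simp add: algebra_simps)
      then show ?thesis
        unfolding mult.assoc[symmetric] e t1 t2' y by (simp add: algebra_simps)
    qed
  qed
  have "moment N k (i + 1) + qpow (2 * i + 1) * moment N k (i - 1)
      + qpow (i + 1) * (moment N (k - 1) i + moment N (k + 1) i)
      = (\<Sum>s\<in>?I. alt_sign s * (qpow (tri (i + 1 + s)) * sl2_mult k (node_poly N s)
          + qpow (2 * i + 1) * (qpow (tri (i - 1 + s)) * sl2_mult k (node_poly N s))
      + qpow (i + 1) * (qpow (tri (i + s))
          * (sl2_mult (k - 1) (node_poly N s) + sl2_mult (k + 1) (node_poly N s)))))"
    unfolding moment_def sum_distrib_left sum.distrib[symmetric]
    by (intro sum.cong refl) (simp add: algebra_simps)
  also have "\<dots> = (\<Sum>s\<in>?I. alt_sign s * (qpow (i + 1) * qpow (tri (i + s)) * (?A - ?\<delta> s)))"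
    by (intro sum.cong refl) (simp only: pointwise)
  also have "\<dots> = qpow (i + 1) * (\<Sum>s\<in>?I. alt_sign s * qpow (tri (i + s))) * ?A
      - (\<Sum>s\<in>?I. alt_sign s * (qpow (i + 1) * qpow (tri (i + s)) * ?\<delta> s))"
    unfolding sum_distrib_left sum_distrib_right sum_subtractf[symmetric]
    by (intro sum.cong refl) (simp only: right_diff_distrib mult_ac)
  also have "(\<Sum>s\<in>?I. alt_sign s * (qpow (i + 1) * qpow (tri (i + s)) * ?\<delta> s))
      = (\<Sum>s\<in>{0}. alt_sign s * (qpow (i + 1) * qpow (tri (i + s)) * ?\<delta> s))"
    by (rule sum.mono_neutral_right) auto
  finally have eq: "moment N k (i + 1) + qpow (2 * i + 1) * moment N k (i - 1)
      + qpow (i + 1) * (moment N (k - 1) i + moment N (k + 1) i)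
      + (if k = 1 then qpow (i + 1) * qpow (tri i) * (qfac N)\<^sup>2 else 0)
      = qpow (i + 1) * (\<Sum>s\<in>?I. alt_sign s * qpow (tri (i + s))) * ?A"
    by simp
  have "fps_X ^ Suc N dvd qpow (i + 1) * (\<Sum>s\<in>?I. alt_sign s * qpow (tri (i + s)) :: 'a fps)"
  proof -
    have "fps_X ^ Suc N dvd (qpow (i + 1) * qpow (int N - i) :: 'a fps)"
      unfolding qpow_def power_add[symmetric] using i by (intro le_imp_power_dvd) auto
    also have "\<dots> dvd qpow (i + 1) * (\<Sum>s\<in>?I. alt_sign s * qpow (tri (i + s)) :: 'a fps)"
      using i by (intro mult_dvd_mono qpow_dvd_alternating_sum) auto
    finally show ?thesis .
  qed
  then show ?thesis
    unfolding congr_def diff_minus_eq_add add.assoc[symmetric] eq by (rule dvd_mult2)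
qed

text \<open>
  The recurrence determines the moments from \<open>moment N k 0\<close> and from \<open>moment N k (-1)\<close>, which coincide
  by \<open>moment_reflect\<close>. The right-hand side satisfies it because, for \<open>i \<ge> 1\<close> and \<open>k \<ge> 1\<close>, the function
  \<open>\<sigma> k i = (if 1 \<le> k \<and> k \<le> i then (-1)\<^sup>k else 0)\<close> satisfies
  \<open>\<sigma> k (i + 1) + \<sigma> k (i - 1) + \<sigma> (k - 1) i + \<sigma> (k + 1) i = (if k = 1 then -1 else 0)\<close>.
\<close>
lemma moment_congr:
  "congr (fps_X ^ Suc N) (moment N k (int i))
    ((if 1 \<le> k \<and> k \<le> i then (- 1) ^ k else 0) * (qfac N)\<^sup>2 * qpow (tri (int i)))"
proof -
  let ?q = "fps_X ^ Suc N :: 'a fps"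
  let ?\<sigma> = "\<lambda>k i. if 1 \<le> k \<and> k \<le> i then (- 1) ^ k else 0 :: 'a fps"
  let ?t = "\<lambda>k i. ?\<sigma> k i * (qfac N)\<^sup>2 * qpow (tri (int i))"
  have w0: "moment N 0 i = 0" for i
    by (simp add: moment_def)
  have "(\<forall>k. congr ?q (moment N k (int i)) (?t k i)) \<and> (\<forall>k. congr ?q (moment N k (int i + 1))
      (?t k (Suc i)))"
  proof (induction i)
    case 0
    have "congr ?q (moment N k 1) (?t k 1)" for k
    proof (cases "k = 0")
      case False
      have "moment N k (0 - 1) = (moment N k 0 :: 'a fps)" using moment_reflect[of N k 0] by simp
      then have "congr ?q (- (qpow (2 * 0 + 1) * moment N k (0 - 1)
          + qpow (0 + 1) * (moment N (k - 1) 0 + moment N (k + 1) 0)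
          + (if k = 1 then qpow (0 + 1) * qpow (tri 0) * (qfac N)\<^sup>2 else 0)))
          (0 - (qpow (2 * 0 + 1) * 0 + qpow (0 + 1) * (0 + 0)
              + (if k = 1 then qpow (0 + 1) * qpow (tri 0) * (qfac N)\<^sup>2 else 0)))"
        unfolding diff_0[symmetric]
        by (intro congr_diff congr_add congr_mult congr_refl)
            (simp_all add: moment_0_congr del: power_Suc)
      with moment_recurrence[of 0 k N, where 'a = 'a] False
      have "congr ?q (moment N k 1) (- (if k = 1 then qpow 1 * (qfac N)\<^sup>2 else 0))"
        by (auto dest: congr_trans simp del: power_Suc)
      moreover have "tri 1 = 1" by (simp add: tri_def)
      ultimately show ?thesis
        using False by (cases "k = 1") (auto simp: mult.commute simp del: power_Suc)
    qed (simp add: w0)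
    then show ?case
      using moment_0_congr[where 'a = 'a] by (simp del: power_Suc)
  next
    case (Suc i)
    have "congr ?q (moment N k (int (Suc i) + 1)) (?t k (Suc (Suc i)))" for k
    proof (cases "k = 0")
      case False
      let ?j = "int (Suc i)"
      have "congr ?q (moment N k (?j + 1))
          (- (qpow (2 * ?j + 1) * moment N k (?j - 1)
              + qpow (?j + 1) * (moment N (k - 1) ?j + moment N (k + 1) ?j)
          + (if k = 1 then qpow (?j + 1) * qpow (tri ?j) * (qfac N)\<^sup>2 else 0)))"
        using False by (intro moment_recurrence) auto
      also have "congr ?q \<dots> (- (qpow (2 * ?j + 1) * ?t k i
          + qpow (?j + 1) * (?t (k - 1) (Suc i) + ?t (k + 1) (Suc i))
          + (if k = 1 then qpow (?j + 1) * qpow (tri ?j) * (qfac N)\<^sup>2 else 0)))"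
      proof -
        have j: "?j - 1 = int i" "?j = int i + 1" by simp_all
        have "congr ?q (moment N k (?j - 1)) (?t k i)"
            "congr ?q (moment N k ?j) (?t k (Suc i))" for k
          using Suc.IH unfolding j(1) by (blast, simp only: j(2))
        then show ?thesis
          unfolding diff_0[symmetric] by (intro congr_diff congr_add congr_mult congr_refl)
      qed
      also have "\<dots> = - (qpow (2 * ?j + 1) * qpow (tri (int i)) * (?\<sigma> k i * (qfac N)\<^sup>2)
          + qpow (?j + 1) * qpow (tri ?j)
              * ((?\<sigma> (k - 1) (Suc i) + ?\<sigma> (k + 1) (Suc i) + (if k = 1 then 1 else 0))
                  * (qfac N)\<^sup>2))"
        by (simp add: algebra_simps)
      also have "qpow (2 * ?j + 1) * qpow (tri (int i)) = (qpow (tri (?j + 1)) :: 'a fps)"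
      proof -
        have "2 * ?j + 1 + tri (int i) = tri (?j + 1)"
          using tri_minus_1[of ?j] tri_plus_1[of ?j] by simp
        then show ?thesis
          by (subst qpow_add[symmetric]) (auto simp del: of_nat_Suc)
      qed
      also have "qpow (?j + 1) * qpow (tri ?j) = (qpow (tri (?j + 1)) :: 'a fps)"
      proof -
        have "?j + 1 + tri ?j = tri (?j + 1)"
          using tri_plus_1[of ?j] by simp
        then show ?thesis
          by (subst qpow_add[symmetric]) (auto simp del: of_nat_Suc)
      qed
      also have "- (qpow (tri (?j + 1)) * (?\<sigma> k i * (qfac N)\<^sup>2)
          + qpow (tri (?j + 1)) * ((?\<sigma> (k - 1) (Suc i) + ?\<sigma> (k + 1) (Suc i)
              + (if k = 1 then 1 else 0)) * (qfac N)\<^sup>2))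
          = - (?\<sigma> k i + ?\<sigma> (k - 1) (Suc i) + ?\<sigma> (k + 1) (Suc i) + (if k = 1 then 1 else 0))
              * (qfac N)\<^sup>2 * qpow (tri (?j + 1))"
        by (simp add: algebra_simps)
      also have "- (?\<sigma> k i + ?\<sigma> (k - 1) (Suc i) + ?\<sigma> (k + 1) (Suc i) + (if k = 1 then 1 else 0))
          = ?\<sigma> k (Suc (Suc i))"
      proof -
        obtain k' where k': "k = Suc k'" using False by (cases k) auto
        consider "k' = 0" | "1 \<le> k'" "k' < i" | "1 \<le> k'" "k' = i" | "1 \<le> k'" "k' = Suc i"
            | "k' > Suc i"
          by linarith
        then show ?thesis
          by cases (auto simp: k')
      qed
      finally show ?thesis
        by (simp add: add.commute)
    qed (simp add: w0)
    then show ?case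
      using Suc.IH by (simp add: add.commute del: power_Suc)
  qed
  then show ?thesis
    by blast
qed

section \<open>Coefficients and nonnegativity\<close>

lemma fps_X_power_dvd_iff:
  "fps_X ^ n dvd F \<longleftrightarrow> (\<forall>i<n. fps_nth F i = 0)" for F :: "'a::comm_ring_1 fps"
proof
  assume "fps_X ^ n dvd F"
  then show "\<forall>i<n. fps_nth F i = 0"
    by (auto simp: dvd_def fps_X_power_mult_nth)
next
  assume zero: "\<forall>i<n. fps_nth F i = 0"
  have "F = fps_X ^ n * Abs_fps (\<lambda>i. fps_nth F (i + n))"
    by (rule fps_ext) (use zero in \<open>auto simp: fps_X_power_mult_nth\<close>)
  then show "fps_X ^ n dvd F"
    by (rule dvdI)
qed

lemma congr_fps_iff: "congr (fps_X ^ n) F G \<longleftrightarrow> (\<forall>i<n. fps_nth F i = fps_nth G i)"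
  by (simp add: congr_def fps_X_power_dvd_iff)

definition nonneg_series :: "qzseries \<Rightarrow> bool" where
  "nonneg_series F \<longleftrightarrow> (\<forall>n s. 0 \<le> qzcoeff F n s)"

lemma nonneg_series_0 [simp]: "nonneg_series 0"
  by (simp add: nonneg_series_def qzcoeff_def)

lemma nonneg_series_1 [simp]: "nonneg_series 1"
  by (simp add: nonneg_series_def qzcoeff_def lookup_one when_def)

lemma nonneg_series_add: "nonneg_series F \<Longrightarrow> nonneg_series G \<Longrightarrow> nonneg_series (F + G)"
  by (simp add: nonneg_series_def qzcoeff_def lookup_add)

lemma nonneg_series_mult:
  assumes "nonneg_series F" "nonneg_series G"
  shows "nonneg_series (F * G)"
  unfolding nonneg_series_def
proof (intro allI)
  fix n s
  have Sum_any_nonneg: "0 \<le> Sum_any f" if "\<And>x. 0 \<le> f x" for f :: "int \<Rightarrow> int"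
    unfolding Sum_any.expand_set by (rule sum_nonneg) (rule that)
  have "0 \<le> Poly_Mapping.lookup (fps_nth F i * fps_nth G j) s" for i j
    using assms unfolding lookup_mult nonneg_series_def qzcoeff_def
    by (intro Sum_any_nonneg mult_nonneg_nonneg) (auto simp: when_def)
  then show "0 \<le> qzcoeff (F * G) n s"
    by (simp add: qzcoeff_def fps_mult_nth lookup_sum sum_nonneg)
qed

lemma nonneg_series_sum: "(\<And>i. i \<in> S \<Longrightarrow> nonneg_series (f i)) \<Longrightarrow> nonneg_series (sum f S)"
  by (induction S rule: infinite_finite_induct) (auto intro: nonneg_series_add)

lemma nonneg_series_prod: "(\<And>i. i \<in> S \<Longrightarrow> nonneg_series (f i)) \<Longrightarrow> nonneg_series (prod f S)"
  by (induction S rule: infinite_finite_induct) (auto intro: nonneg_series_mult)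

lemma nonneg_series_fps_X_power: "nonneg_series (fps_X ^ m)"
  by (auto simp: nonneg_series_def qzcoeff_def fps_X_power_iff lookup_one when_def)

lemma nonneg_series_geom: "nonneg_series (geom m)"
  by (auto simp: nonneg_series_def qzcoeff_def geom_def lookup_one when_def)

lemma nonneg_series_iqfac: "nonneg_series (iqfac n)"
  unfolding iqfac_def by (intro nonneg_series_prod nonneg_series_geom)

lemma nonneg_series_of_nat: "nonneg_series (of_nat n)"
  by (induction n) (auto intro: nonneg_series_add)

definition nonneg_poly :: "qzseries poly \<Rightarrow> bool" where
  "nonneg_poly p \<longleftrightarrow> (\<forall>r. nonneg_series (coeff p r))"

lemma nonneg_poly_0 [simp]: "nonneg_poly 0"
  by (simp add: nonneg_poly_def)

lemma nonneg_poly_1 [simp]: "nonneg_poly 1"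
  by (simp add: nonneg_poly_def coeff_1)

lemma nonneg_poly_pCons [simp]: "nonneg_poly (pCons a p) \<longleftrightarrow> nonneg_series a \<and> nonneg_poly p"
  by (auto simp: nonneg_poly_def coeff_pCons split: nat.splits)

lemma nonneg_poly_add: "nonneg_poly p \<Longrightarrow> nonneg_poly r \<Longrightarrow> nonneg_poly (p + r)"
  by (simp add: nonneg_poly_def nonneg_series_add)

lemma nonneg_poly_smult: "nonneg_series a \<Longrightarrow> nonneg_poly p \<Longrightarrow> nonneg_poly (smult a p)"
  by (simp add: nonneg_poly_def nonneg_series_mult)

lemma nonneg_poly_mult: "nonneg_poly p \<Longrightarrow> nonneg_poly r \<Longrightarrow> nonneg_poly (p * r)"
  by (auto simp: nonneg_poly_def coeff_mult intro!: nonneg_series_sum nonneg_series_mult)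

lemma nonneg_poly_prod: "(\<And>i. i \<in> S \<Longrightarrow> nonneg_poly (f i)) \<Longrightarrow> nonneg_poly (prod f S)"
  by (induction S rule: infinite_finite_induct) (auto intro: nonneg_poly_mult)

lemma nonneg_series_sl2_mult: "nonneg_poly p \<Longrightarrow> nonneg_series (sl2_mult k p)"
  by (auto simp: sl2_mult_def nonneg_poly_def intro!:
      nonneg_series_sum nonneg_series_mult nonneg_series_of_nat)

lemma nonneg_poly_g_factor: "nonneg_poly (g_factor m)"
  by (simp add: g_factor_def nonneg_series_add nonneg_series_fps_X_power)

text \<open>
  Let \<open>f = F_prod N / (q)\<^sub>N\<close>, \<open>p = F_quot N / (q)\<^sub>N\<close>, \<open>x = q\<^sup>N\<^sup>+\<^sup>1\<close> and \<open>g = 1 / (1 - x)\<close>. The step from \<open>N\<close> to \<open>N + 1\<close> turns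
  \<open>p\<close> into \<open>p + x (f - p) + x\<^sup>2 g f\<close> and \<open>f - p\<close> into \<open>(f - p) + x p + (x\<^sup>2 g + x g c) f\<close>. Hence the two
  assertions support each other in the induction, although the recursion for \<open>F_quot\<close> itself has the
  factor \<open>(1 - x)\<^sup>2\<close> with a negative coefficient.
\<close>
lemma nonneg_poly_F_quot:
  "nonneg_poly (smult (iqfac N) (F_quot N)) \<and> nonneg_poly (smult (iqfac N) (F_prod N - F_quot N))"
proof (induction N)
  case (Suc N)
  define x g where "x = (fps_X ^ Suc N :: qzseries)" and "g = (geom (Suc N) :: qzseries)"
  define p f :: "qzseries poly" where "p = smult (iqfac N) (F_quot N)" and "f
      = smult (iqfac N) (F_prod N)"
  have g: "g = 1 + x * g"
    using geom_inverse[of "Suc N", where 'a = laurent] by (simp add: x_def g_def algebra_simps)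
  have p_Suc: "smult (iqfac (Suc N)) (F_quot (Suc N)) = smult (g * (1 - x)\<^sup>2) p + smult (g * x) f"
    by (simp add: p_def f_def x_def g_def smult_add_right mult_ac del: power_Suc)
  have f_Suc: "smult (iqfac (Suc N)) (F_prod (Suc N)) = smult g (g_factor (Suc N)) * f"
    by (simp add: f_def g_def F_prod_Suc mult_ac)
  have g1: "g * (1 - x)\<^sup>2 = 1 - x" "g * x = x + x * x * g"
  proof -
    have "g * (1 - x) = 1"
      using g by (simp add: algebra_simps)
    then show "g * (1 - x)\<^sup>2 = 1 - x"
      by (simp add: power2_eq_square mult.assoc[symmetric])
    show "g * x = x + x * x * g"
      by (subst g) (simp add: algebra_simps)
  qed
  have pos: "nonneg_poly p" "nonneg_poly (f - p)" "nonneg_poly f"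
    using Suc.IH nonneg_poly_add[of p "f - p"] by (simp_all add: p_def f_def smult_diff_right)
  have coeffs: "nonneg_series x" "nonneg_series g" "nonneg_series (x * x * g)"
      "nonneg_series (g * x)"
    by (auto simp: x_def g_def intro!:
        nonneg_series_mult nonneg_series_fps_X_power nonneg_series_geom simp del: power_Suc)
  have "smult (iqfac (Suc N)) (F_quot (Suc N)) = p + smult x (f - p) + smult (x * x * g) f"
    unfolding p_Suc g1 by (simp add: smult_diff_left smult_diff_right smult_add_left)
  moreover have "smult (iqfac (Suc N)) (F_prod (Suc N) - F_quot (Suc N))
      = (f - p) + smult x p + [:x * x * g, g * x:] * f"
  proof -
    have "smult g (g_factor (Suc N)) = [:g * (1 - x)\<^sup>2 + (g * x + g * x), g * x:]"
    proof -
      have "fps_X ^ (2 * Suc N) = x * x"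
        unfolding x_def mult_2 power_add ..
      then show ?thesis
        unfolding g_factor_def x_def[symmetric]
            by (simp only:) (simp add: power2_eq_square algebra_simps)
    qed
    also have "\<dots> = [:1 - x + ((x + x * x * g) + (x + x * x * g)), g * x:]"
      unfolding g1 ..
    finally have f': "smult (iqfac (Suc N)) (F_prod (Suc N))
        = [:1 - x + ((x + x * x * g) + (x + x * x * g)), g * x:] * f"
      unfolding f_Suc by simp
    show ?thesis
      unfolding smult_diff_right f' unfolding p_Suc g1
      by (simp add: smult_diff_left smult_diff_right smult_add_left algebra_simps numeral_poly)
  qed
  ultimately show ?case
    using pos coeffs by (auto intro!: nonneg_poly_add nonneg_poly_smult nonneg_poly_mult)
qed simp

lemma nonneg_series_iqfac_sl2_mult_node_poly: "nonneg_series (iqfac N * sl2_mult k (node_poly N s))"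
proof (cases "s = 0")
  case True
  have "nonneg_series (sl2_mult k (smult (iqfac N) (F_quot N)))"
    using nonneg_poly_F_quot by (intro nonneg_series_sl2_mult) blast
  then show ?thesis
    using True by (simp add: node_poly_def sl2_mult_smult)
next
  case False
  have "nonneg_poly (node_poly N s)"
    using False by (auto simp: node_poly_def qpow_def F_omit_def intro!:
        nonneg_poly_smult nonneg_poly_prod nonneg_poly_g_factor nonneg_series_fps_X_power)
  then show ?thesis
    by (intro nonneg_series_mult nonneg_series_iqfac nonneg_series_sl2_mult)
qed

section \<open>The series J modulo a power of q\<close>

definition zmon :: "int \<Rightarrow> qzseries" where
  "zmon s = fps_const (zpow s)"

lemma zmon_0: "zmon 0 = 1"
  by (simp add: zmon_def zpow_def single_one)

lemma zmon_add: "zmon (a + b) = zmon a * zmon b"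
  by (simp add: zmon_def zpow_def mult_single)

lemma nonneg_series_zmon: "nonneg_series (zmon s)"
  by (auto simp: zmon_def nonneg_series_def qzcoeff_def zpow_def lookup_single when_def)

lemma chi_telescope: "(1 - zmon 1) * fps_const (chi j) = zmon (- int j) - zmon (int j + 1)"
proof -
  have chi: "fps_const (chi j) = (\<Sum>u = - int j..int j. zmon u)"
  proof -
    have "fps_const (sum f U) = (\<Sum>u\<in>U. fps_const (f u))" for f :: "int \<Rightarrow> laurent" and U
      by (induction U rule: infinite_finite_induct) (simp_all flip: fps_const_add)
    then show ?thesis
      by (simp add: chi_def zmon_def)
  qed
  have "(1 - zmon 1) * fps_const (chi j)
      = (\<Sum>u = - int j..int j. zmon u) - (\<Sum>u = - int j..int j. zmon (u + 1))"
  proof -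
    have "(\<Sum>u = - int j..int j. zmon (u + 1)) = zmon 1 * (\<Sum>u = - int j..int j. zmon u)"
      unfolding sum_distrib_left by (intro sum.cong refl) (simp only: zmon_add mult.commute)
    then show ?thesis
      by (simp only: chi left_diff_distrib mult_1_left)
  qed
  also have "\<dots> = (\<Sum>u = - int j..int j. zmon u) - (\<Sum>u = - int j + 1..int j + 1. zmon u)"
    by (simp only: sum_shift_int)
  also have "(\<Sum>u = - int j..int j. zmon u) = zmon (- int j) + (\<Sum>u = - int j + 1..int j. zmon u)"
    by (subst sum.remove[of _ "- int j"]) (auto intro!: sum.cong)
  also have "(\<Sum>u = - int j + 1..int j + 1. zmon u)
      = zmon (int j + 1) + (\<Sum>u = - int j + 1..int j. zmon u)"
    by (subst sum.remove[of _ "int j + 1"]) (auto intro!: sum.cong)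
  finally show ?thesis
    by simp
qed

lemma qpow_tri: "qpow (tri (int j)) = fps_X ^ Tri j"
proof -
  have "2 * int (Tri j) = 2 * tri (int j)"
  proof -
    have "even ((j + 1) * j)" by simp
    then have "2 * Tri j = (j + 1) * j"
      unfolding Tri_def choose_two by simp
    then show ?thesis
      unfolding tri_double by (metis add.commute mult.commute of_nat_1 of_nat_add of_nat_mult of_nat_numeral)
  qed
  then show ?thesis
    by (simp add: qpow_def flip: nat_int_comparison)
qed

text \<open>
  The factors with index \<open>m \<ge> N\<close> are congruent to \<open>1\<close>, as \<open>a\<close> is divisible by \<open>q\<close>; convergence of the product
  carries the congruence over to the limit.
\<close>
lemma qpoch_inf_congr:
  assumes "fps_nth a 0 = 0"
  shows "congr (fps_X ^ Suc N) (qpoch_inf a) (\<Prod>m<N. 1 - a * fps_X ^ m)"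
proof -
  let ?P = "\<lambda>n. \<Prod>m<n. 1 - a * fps_X ^ m"
  have "fps_X ^ 1 dvd a"
    using assms by (simp only: fps_X_power_dvd_iff) simp
  then obtain b where a: "a = fps_X * b"
    by (auto simp: dvd_def)
  have "congr (fps_X ^ Suc N) (?P (N + d)) (?P N)" for d
  proof (induction d)
    case (Suc d)
    have "congr (fps_X ^ Suc N) (1 - a * fps_X ^ (N + d)) 1"
      by (auto simp: congr_def a power_add)
    then have "congr (fps_X ^ Suc N) (?P (N + d) * (1 - a * fps_X ^ (N + d))) (?P N * 1)"
      by (rule congr_mult[OF Suc])
    then show ?case
      by simp
  qed simp
  then have stable: "congr (fps_X ^ Suc N) (?P n) (?P N)" if "N \<le> n" for n
    using that le_Suc_ex by blast
  have lim: "?P \<longlonglongrightarrow> qpoch_inf a"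
    using has_prod_imp_tendsto'[OF qpoch_inf_has_prod[OF assms]] .
  show ?thesis
    unfolding congr_fps_iff
  proof (intro allI impI)
    fix i assume i: "i < Suc N"
    have "\<forall>\<^sub>F n in sequentially. fps_nth (?P n) i = fps_nth (qpoch_inf a) i \<and> N \<le> n"
      using lim eventually_ge_at_top[of N] unfolding tendsto_fps_iff
          by (auto intro: eventually_conj)
    then obtain n where "fps_nth (?P n) i = fps_nth (qpoch_inf a) i" "N \<le> n"
      by (metis (mono_tags, lifting) eventually_happens trivial_limit_sequentially)
    then show "fps_nth (qpoch_inf a) i = fps_nth (?P N) i"
      using stable[of n] i unfolding congr_fps_iff by simp
  qed
qed

lemma J_den_congr:
  "congr (fps_X ^ Suc N) J_den (\<Prod>m<N. (1 - zmon 1 * fps_X ^ Suc m)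
      * (1 - zmon (- 1) * fps_X ^ Suc m))"
proof -
  have "J_den = qpoch_inf (zmon 1 * fps_X) * qpoch_inf (zmon (- 1) * fps_X)"
    by (simp add: J_den_def qpochs_inf_def zmon_def)
  moreover have "congr (fps_X ^ Suc N) (qpoch_inf (zmon 1 * fps_X) * qpoch_inf (zmon (- 1) * fps_X))
      ((\<Prod>m<N. 1 - zmon 1 * fps_X * fps_X ^ m) * (\<Prod>m<N. 1 - zmon (- 1) * fps_X * fps_X ^ m))"
    by (intro congr_mult qpoch_inf_congr) simp_all
  ultimately show ?thesis
    by (simp add: prod.distrib mult.assoc)
qed

lemma J_num_congr:
  assumes "N \<le> L"
  shows "congr (fps_X ^ Suc N) (J_num k)
    (\<Sum>j = k..L. (- 1) ^ (j - k) * fps_X ^ Tri j * fps_const (chi j))"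
  unfolding congr_fps_iff
proof (intro allI impI)
  fix n assume n: "n < Suc N"
  let ?F = "\<lambda>j. (- 1) ^ (j - k) * fps_X ^ Tri j * fps_const (chi j) :: qzseries"
  have zero: "fps_nth (?F j) n = 0" if "L < j" for j
  proof -
    have "fps_X ^ Suc n dvd (qpow (tri (int j)) :: qzseries)"
      unfolding qpow_def using that n assms tri_ge(1)[of "int j"]
          by (intro le_imp_power_dvd) linarith
    then have "fps_X ^ Suc n dvd ?F j"
      unfolding qpow_tri by (intro dvd_mult2 dvd_mult)
    then show ?thesis
      unfolding fps_X_power_dvd_iff by simp
  qed
  have "fps_nth (J_num k) n = (\<Sum>j | j \<in> {k..} \<and> fps_nth (?F j) n \<noteq> 0. fps_nth (?F j) n)"
    by (rule has_sum_fpsD(2)[OF J_num_has_sum])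
  also have "\<dots> = (\<Sum>j = k..L. fps_nth (?F j) n)"
  proof (intro sum.mono_neutral_left)
    show "{j \<in> {k..}. fps_nth (?F j) n \<noteq> 0} \<subseteq> {k..L}"
    proof
      fix j assume "j \<in> {j \<in> {k..}. fps_nth (?F j) n \<noteq> 0}"
      then have "k \<le> j" "\<not> L < j"
        using zero[of j] by blast+
      then show "j \<in> {k..L}" by simp
    qed
  qed auto
  finally show "fps_nth (J_num k) n = fps_nth (\<Sum>j = k..L. ?F j) n"
    by (simp only: fps_sum_nth)
qed

text \<open>
  The claimed formula for \<open>J k\<close>, truncated: the product \<open>F\<close> is cut after \<open>N\<close> factors, and the sum over \<open>s\<close>
  at \<open>|s| = N\<close>, which is harmless because the term for \<open>s\<close> is divisible by \<open>q\<^bsup>|s|\<^esup>\<close>.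
\<close>
definition J_approx :: "nat \<Rightarrow> nat \<Rightarrow> qzseries" where
  "J_approx N k = (\<Sum>s = - int N..int N. zmon s * (iqfac N * sl2_mult k (node_poly N s)))"

lemma nonneg_series_J_approx: "nonneg_series (J_approx N k)"
  unfolding J_approx_def by (intro nonneg_series_sum nonneg_series_mult[OF nonneg_series_zmon] nonneg_series_iqfac_sl2_mult_node_poly)

text \<open>
  Expanding the theta function by the triple product and collecting powers of \<open>z\<close> produces the
  moments. Those for \<open>j\<close> and \<open>- 1 - j\<close> agree and occur with opposite signs, so they combine to
  \<open>z\<^bsup>-j\<^esup> - z\<^bsup>j+1\<^esup> = (1 - z) \<chi>\<^sub>j(z)\<close>.
\<close>
lemma J_approx_times_theta:
  assumes "1 \<le> k"
  shows "congr (fps_X ^ Suc N)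
    (qfac N * ((1 - zmon 1) * (\<Prod>m<N. (1 - zmon 1 * fps_X ^ Suc m)
        * (1 - zmon (- 1) * fps_X ^ Suc m))) * J_approx N k)
    (qfac N * ((1 - zmon 1) * (\<Sum>j = k..2 * N. (- 1) ^ (j - k) * fps_X ^ Tri j
        * fps_const (chi j))))"
proof -
  let ?q = "fps_X ^ Suc N :: qzseries"
  define T :: qzseries where "T = qfac N
      * ((1 - zmon 1) * (\<Prod>m<N. (1 - zmon 1 * fps_X ^ Suc m) * (1 - zmon (- 1) * fps_X ^ Suc m)))"
  define a :: "int \<Rightarrow> qzseries" where "a s = iqfac N * sl2_mult k (node_poly N s)" for s :: int
  define h :: "int \<Rightarrow> qzseries" where "h i
      = alt_sign i * zmon (- i) * (iqfac N * moment N k i)" for i :: int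
  define t :: "int \<Rightarrow> qzseries" where "t i = alt_sign i * zmon (- i) * qpow (tri i)" for i :: int
  define d :: "nat \<Rightarrow> qzseries" where "d j
      = alt_sign (int j) * (zmon (- int j) - zmon (int j + 1))" for j :: nat
  let ?L = "2 * int N"
  have "T * J_approx N k = (\<Sum>s = - int N..int N. T * (zmon s * a s))"
    by (simp only: J_approx_def a_def sum_distrib_left)
  moreover have "congr ?q (\<Sum>s = - int N..int N. T * (zmon s * a s))
      (\<Sum>s = - int N..int N. (\<Sum>i = - ?L - 1 + s..?L + s. t i) * (zmon s * a s))"
    unfolding T_def t_def
    by (intro congr_sum congr_mult congr_refl jacobi_triple_product_congr zmon_0 zmon_add) auto
  ultimately have theta: "congr ?q (T * J_approx N k)
      (\<Sum>s = - int N..int N. (\<Sum>i = - ?L - 1 + s..?L + s. t i) * (zmon s * a s))"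
    by (simp only:)
  have "(\<Sum>s = - int N..int N. (\<Sum>i = - ?L - 1 + s..?L + s. t i) * (zmon s * a s))
      = (\<Sum>s = - int N..int N. (\<Sum>i = - ?L - 1..?L. t (i + s)) * (zmon s * a s))"
    by (simp only: sum_shift_int)
  also have "\<dots> = (\<Sum>s = - int N..int N. \<Sum>i = - ?L - 1..?L.
      alt_sign i * zmon (- i) * (iqfac N
          * (alt_sign s * qpow (tri (i + s)) * sl2_mult k (node_poly N s))))"
    unfolding sum_distrib_right
  proof (intro sum.cong refl)
    fix i s :: int
    have "zmon (- i) = zmon (- (i + s)) * zmon s"
      by (simp flip: zmon_add)
    then show "t (i + s) * (zmon s * a s)
        = alt_sign i * zmon (- i) * (iqfac N
            * (alt_sign s * qpow (tri (i + s)) * sl2_mult k (node_poly N s)))"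
      by (simp only: t_def a_def alt_sign_add mult_ac)
  qed
  also have "\<dots> = (\<Sum>i = - ?L - 1..?L. h i)"
    unfolding h_def moment_def sum_distrib_left by (rule sum.swap)
  also have "\<dots> = (\<Sum>i = - ?L - 1..- 1. h i) + (\<Sum>i = 0..?L. h i)"
    by (subst sum.union_disjoint[symmetric]) (auto intro!: sum.cong)
  also have "(\<Sum>i = - ?L - 1..- 1. h i) = (\<Sum>j = 0..2 * N. h (- 1 - int j))"
    by (rule sum.reindex_bij_witness[where i = "\<lambda>j. - 1 - int j" and j = "\<lambda>i. nat (- 1 - i)"]) auto
  also have "(\<Sum>i = 0..?L. h i) = (\<Sum>j = 0..2 * N. h (int j))"
    by (rule sum.reindex_bij_witness[where i = int and j = nat]) auto
  also have "(\<Sum>j = 0..2 * N. h (- 1 - int j)) + (\<Sum>j = 0..2 * N. h (int j))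
      = (\<Sum>j = 0..2 * N. d j * (iqfac N * moment N k (int j)))"
    unfolding sum.distrib[symmetric]
  proof (intro sum.cong refl)
    fix j
    have "alt_sign (- 1 - int j) = (- alt_sign (int j) :: qzseries)" "- (- 1 - int j) = int j + 1"
      by (auto simp: alt_sign_def)
    then show "h (- 1 - int j) + h (int j) = d j * (iqfac N * moment N k (int j))"
      unfolding h_def d_def moment_reflect by (simp only:) (simp add: algebra_simps)
  qed
  finally have fold: "(\<Sum>s = - int N..int N. (\<Sum>i = - ?L - 1 + s..?L + s. t i) * (zmon s * a s))
      = (\<Sum>j = 0..2 * N. d j * (iqfac N * moment N k (int j)))" .
  \<comment> \<open>The factor \<open>(q)\<^sub>N\<^sup>2\<close> from the moments against \<open>1 / (q)\<^sub>N\<close> in \<open>J_approx\<close> leaves the factor \<open>(q)\<^sub>N\<close>.\<close>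
  have moments: "congr ?q (\<Sum>j = 0..2 * N. d j * (iqfac N * moment N k (int j)))
      (\<Sum>j = 0..2 * N. d j * (iqfac N * ((if 1 \<le> k \<and> k \<le> j then (- 1) ^ k else 0) * (qfac N)\<^sup>2
          * qpow (tri (int j)))))"
    by (intro congr_sum congr_mult congr_refl moment_congr)
  have "(\<Sum>j = 0..2 * N. d j * (iqfac N
      * ((if 1 \<le> k \<and> k \<le> j then (- 1) ^ k else 0) * (qfac N)\<^sup>2 * qpow (tri (int j)))))
      = (\<Sum>j = k..2 * N. d j * (iqfac N * ((- 1) ^ k * (qfac N)\<^sup>2 * qpow (tri (int j)))))"
    using assms by (intro sum.mono_neutral_cong_right) auto
  also have "\<dots> = (\<Sum>j = k..2 * N. qfac N
      * ((1 - zmon 1) * ((- 1) ^ (j - k) * fps_X ^ Tri j * fps_const (chi j))))"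
  proof (intro sum.cong refl)
    fix j assume j: "j \<in> {k..2 * N}"
    have sgn: "alt_sign (int j) * (- 1) ^ k = ((- 1) ^ (j - k) :: qzseries)"
    proof -
      have "alt_sign (int j) = ((- 1) ^ (j - k + k) :: qzseries)"
        using j by (auto simp: alt_sign_def)
      then show ?thesis
        unfolding power_add by (simp add: mult.assoc flip: power_mult_distrib)
    qed
    have "d j * (iqfac N * ((- 1) ^ k * (qfac N)\<^sup>2 * qpow (tri (int j))))
        = (iqfac N * qfac N) * ((alt_sign (int j) * (- 1) ^ k)
            * (zmon (- int j) - zmon (int j + 1)) * (qfac N * qpow (tri (int j))))"
      by (simp only: d_def power2_eq_square mult_ac)
    also have "\<dots> = qfac N * ((1 - zmon 1) * ((- 1) ^ (j - k) * fps_X ^ Tri j * fps_const (chi j)))"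
      unfolding sgn chi_telescope[symmetric] qpow_tri iqfac_qfac by (simp only: mult_ac mult_1_left)
    finally show "d j * (iqfac N * ((- 1) ^ k * (qfac N)\<^sup>2 * qpow (tri (int j))))
        = qfac N * ((1 - zmon 1) * ((- 1) ^ (j - k) * fps_X ^ Tri j * fps_const (chi j)))" .
  qed
  finally show ?thesis
    using congr_trans[OF theta[unfolded fold] moments] by (simp only: T_def sum_distrib_left)
qed

text \<open>
  The element \<open>1 - z\<close> is not a unit, but Laurent polynomials form an integral domain, so it can be
  cancelled in each coefficient separately.
\<close>
lemma congr_cancel_one_minus_z:
  assumes "congr (fps_X ^ n) ((1 - zmon 1) * F) ((1 - zmon 1) * G)"
  shows "congr (fps_X ^ n) F G"
proof -
  have "zpow 1 \<noteq> 1"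
    by (metis lookup_one lookup_single_eq when_def zero_neq_one zpow_def)
  then have c: "1 - zpow 1 \<noteq> 0" by simp
  have "1 - zmon 1 = fps_const (1 - zpow 1)"
    by (simp add: zmon_def flip: fps_const_1_eq_1 fps_const_sub)
  with assms c show ?thesis
    by (simp add: congr_fps_iff)
qed

lemma J_congr:
  assumes "1 \<le> k"
  shows "congr (fps_X ^ Suc N) (J k) (J_approx N k)"
proof -
  let ?q = "fps_X ^ Suc N :: qzseries"
  define D :: qzseries where "D = (\<Prod>m<N. (1 - zmon 1 * fps_X ^ Suc m)
      * (1 - zmon (- 1) * fps_X ^ Suc m))"
  define S where "S = (\<Sum>j = k..2 * N. (- 1) ^ (j - k) * fps_X ^ Tri j
      * fps_const (chi j) :: qzseries)"
  have "congr ?q (qfac N * ((1 - zmon 1) * D) * J_approx N k) (qfac N * ((1 - zmon 1) * S))"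
    unfolding D_def S_def by (rule J_approx_times_theta[OF assms])
  then have "congr ?q (qfac N * ((1 - zmon 1) * (D * J_approx N k))) (qfac N * ((1 - zmon 1) * S))"
    by (simp only: mult.assoc)
  then have "congr ?q ((1 - zmon 1) * (D * J_approx N k)) ((1 - zmon 1) * S)"
    by (rule congr_cancel_unit[OF _ iqfac_qfac])
  then have DS: "congr ?q (D * J_approx N k) S"
    by (rule congr_cancel_one_minus_z)
  have JD: "congr ?q (J_den * J_approx N k) (D * J_approx N k)"
    unfolding D_def by (intro congr_mult J_den_congr congr_refl)
  have JS: "congr ?q (J_num k) S"
    unfolding S_def by (rule J_num_congr) simp
  have "J_num k = J_den * J k"
    using J_times_den[of k] by (simp only: mult.commute)
  then have "congr ?q (J_den * J k) (J_den * J_approx N k)"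
    using congr_trans[OF JS congr_sym[OF congr_trans[OF JD DS]]] by (simp only:)
  moreover have "fps_right_inverse J_den 1 * J_den = 1"
    using fps_right_inverse[of J_den 1] by (simp add: J_den_nth_0 mult.commute)
  ultimately show ?thesis
    by (rule congr_cancel_unit)
qed

theorem theorem1p2:
  fixes k :: nat
  assumes "k \<ge> 1"
  shows "\<forall>(n::nat) (s::int). qzcoeff (J k) n s \<ge> 0"
proof (intro allI)
  fix n s
  have "fps_nth (J k) n = fps_nth (J_approx n k) n"
    using J_congr[OF assms, of n] by (simp add: congr_fps_iff del: power_Suc)
  then show "0 \<le> qzcoeff (J k) n s"
    using nonneg_series_J_approx[of n k] by (simp add: nonneg_series_def qzcoeff_def)
qed

end
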